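(* Let $\Gamma$ be a $4$-regular infinite planar tessellation with non-negative combinatorial curvature. For $i=1,2$ let $\sigma_i$ be a face of degree $k_i\ge 8$, with $\sigma_1\ne\sigma_2$. Then $U_1(\sigma_1)\cap U_1(\sigma_2)=\emptyset$.
   Context: A planar tessellation is a locally finite, connected, simple graph embedded in $\mathbb S^2$ or $\mathbb R^2$, with faces the components of the complement, such that: (i) every closed face is a closed disk bounded by finitely many edges; (ii) every edge lies in exactly two different closed faces; (iii) two distinct closed faces intersect in the empty set, a single vertex, or the closure of a single edge; all vertex and face degrees (face degree = number of boundary edges) are at least $3$. Infinite means embedded in $\mathbb R^2$. The combinatorial curvature at a vertex $x$ is $\Phi(x)=1-\frac{|x|}{2}+\sum_{\sigma}\frac{1}{|\sigma|}$, summed over faces whose closure contains $x$; non-negative curvature means $\Phi\ge0$ at every vertex. $4$-regular means all vertices have degree $4$. For a face $\sigma$, $\partial\sigma$ is the set of vertices in the closure of $\sigma$, and the $1$-neighborhood is $U_1(\sigma)=\partial\sigma\cup\{x\in V: x\sim z\text{ for some }z\in\partial\sigma\}$, where $x\sim z$ means $x,z$ are adjacent. *)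

theory Defs
  imports "HOL-Analysis.Analysis"
begin

text \<open>
  The plane is represented by the type \<^typ>\<open>complex\<close>. A plane graph is a pair \<open>(V, E)\<close> of a set
  of points and a set of closed edges, each edge being the image of an arc; the two endpoints of an
  edge \<open>e\<close> are the elements of \<open>e \<inter> V\<close>.
\<close>

definition adjacent :: "complex set \<Rightarrow> complex set set \<Rightarrow> complex \<Rightarrow> complex \<Rightarrow> bool" where
  "adjacent V E x y \<longleftrightarrow> x \<noteq> y \<and> (\<exists>e\<in>E. e \<inter> V = {x, y})"

definition vertex_degree :: "complex set set \<Rightarrow> complex \<Rightarrow> nat" where
  "vertex_degree E x = card {e \<in> E. x \<in> e}"

definition faces :: "complex set \<Rightarrow> complex set set \<Rightarrow> complex set set" where
  "faces V E = components (- (V \<union> \<Union>E))"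

definition boundary_edges :: "complex set set \<Rightarrow> complex set \<Rightarrow> complex set set" where
  "boundary_edges E \<sigma> = {e \<in> E. e \<subseteq> closure \<sigma>}"

definition face_degree :: "complex set set \<Rightarrow> complex set \<Rightarrow> nat" where
  "face_degree E \<sigma> = card (boundary_edges E \<sigma>)"

text \<open>
  Simplicity: there are no loops because the endpoints of an arc are distinct, and no multiple edges
  by \<open>edge_unique\<close>. Local finiteness is that of the embedding; it implies that every vertex has
  finite degree.
\<close>

locale plane_graph =
  fixes V :: "complex set" and E :: "complex set set"
  assumes edge_arc:
      "e \<in> E \<Longrightarrow> \<exists>g. arc g \<and> path_image g = e \<and> e \<inter> V = {pathstart g, pathfinish g}"
    and edge_inter: "e \<in> E \<Longrightarrow> e' \<in> E \<Longrightarrow> e \<noteq> e' \<Longrightarrow> e \<inter> e' \<subseteq> V"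
    and edge_unique: "e \<in> E \<Longrightarrow> e' \<in> E \<Longrightarrow> e \<inter> V = e' \<inter> V \<Longrightarrow> e = e'"
    and locally_finite: "\<exists>r>0. finite {e \<in> E. e \<inter> ball p r \<noteq> {}}"
    and connected_graph: "x \<in> V \<Longrightarrow> y \<in> V \<Longrightarrow> (adjacent V E)\<^sup>*\<^sup>* x y"

locale infinite_planar_tessellation = plane_graph +
  assumes face_disk: "\<sigma> \<in> faces V E \<Longrightarrow> closure \<sigma> homeomorphic cball (0::complex) 1"
    and face_bounded_by_edges: "\<sigma> \<in> faces V E \<Longrightarrow>
      finite (boundary_edges E \<sigma>) \<and> frontier (closure \<sigma>) = \<Union>(boundary_edges E \<sigma>)"
    and edge_two_faces: "e \<in> E \<Longrightarrow> card {\<sigma> \<in> faces V E. e \<subseteq> closure \<sigma>} = 2"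
    and face_inter: "\<sigma> \<in> faces V E \<Longrightarrow> \<tau> \<in> faces V E \<Longrightarrow> \<sigma> \<noteq> \<tau> \<Longrightarrow>
      closure \<sigma> \<inter> closure \<tau> = {} \<or> (\<exists>x\<in>V. closure \<sigma> \<inter> closure \<tau> = {x}) \<or>
      (\<exists>e\<in>E. closure \<sigma> \<inter> closure \<tau> = e)"
    and vertex_degree_ge_3: "x \<in> V \<Longrightarrow> vertex_degree E x \<ge> 3"
    and face_degree_ge_3: "\<sigma> \<in> faces V E \<Longrightarrow> face_degree E \<sigma> \<ge> 3"

definition curvature :: "complex set \<Rightarrow> complex set set \<Rightarrow> complex \<Rightarrow> real" where
  "curvature V E x = 1 - real (vertex_degree E x) / 2 +
     (\<Sum>\<sigma> \<in> {\<sigma> \<in> faces V E. x \<in> closure \<sigma>}. 1 / real (face_degree E \<sigma>))"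

definition face_vertices :: "complex set \<Rightarrow> complex set \<Rightarrow> complex set" where
  "face_vertices V \<sigma> = V \<inter> closure \<sigma>"

definition neighborhood1 :: "complex set \<Rightarrow> complex set set \<Rightarrow> complex set \<Rightarrow> complex set" where
  "neighborhood1 V E \<sigma> =
     face_vertices V \<sigma> \<union> {x \<in> V. \<exists>z \<in> face_vertices V \<sigma>. adjacent V E x z}"

end

theory Submission imports Defs begin

text \<open>
  At a vertex of a face \<open>s\<close> of degree at least 8, non-negative curvature leaves only triangles and at
  most one square as the other three faces. So two such faces \<open>s\<close>, \<open>t\<close> share no vertex, and the
  surroundings of each are so rigid that any contact between their 1-neighbourhoods propagates:
  consider the vertices of \<open>s\<close> and \<open>t\<close> that meet the strip between the two faces, together with the
  strip itself, namely the common neighbours of \<open>s\<close> and \<open>t\<close> and the adjacent pairs formed by the tip of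
  a triangle resting on an edge of \<open>s\<close> and the tip of a triangle resting on an edge of \<open>t\<close>. This
  finite set is closed under adjacency, so by connectedness it would be all of \<open>V\<close>. But a finite
  plane graph has an unbounded face, whose closure is not a disk.

  The cyclic order of edges and faces around a vertex needs no orientation: a face has exactly two
  boundary edges at each of its vertices, an edge lies on two faces, and two faces share at most one
  edge, so around a vertex of degree 4 the incidences form a 4-cycle.
\<close>

section \<open>Four-regular maps\<close>

text \<open>\<open>inc f x y\<close> stands for: the edge \<open>xy\<close> lies on the boundary of the face \<open>f\<close>.\<close>

locale four_regular_map =
  fixes inc :: "'f \<Rightarrow> 'v \<Rightarrow> 'v \<Rightarrow> bool"
  assumes inc_sym: "inc f x y \<Longrightarrow> inc f y x"
    and inc_neq: "inc f x y \<Longrightarrow> x \<noteq> y"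
    and corner: "inc f x y \<Longrightarrow> \<exists>z. z \<noteq> y \<and> (\<forall>w. inc f x w \<longleftrightarrow> w = y \<or> w = z)"
    and two_faces: "inc f x y \<Longrightarrow> \<exists>g. g \<noteq> f \<and> (\<forall>h. inc h x y \<longleftrightarrow> h = f \<or> h = g)"
    and four_neighbours: "inc f x y \<Longrightarrow> card {z. \<exists>g. inc g x z} = 4"
    and faces_meet: "\<lbrakk>f \<noteq> g; x \<noteq> y; inc f x x1; inc g x x2; inc f y y1; inc g y y2\<rbrakk>
      \<Longrightarrow> inc f x y \<and> (\<forall>z z1 z2. inc f z z1 \<longrightarrow> inc g z z2 \<longrightarrow> z = x \<or> z = y)"
begin

section \<open>Incidences and cyclic order around a vertex of degree 4\<close>

definition adj :: "'v \<Rightarrow> 'v \<Rightarrow> bool" where "adj x y \<longleftrightarrow> (\<exists>f. inc f x y)"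

definition on :: "'f \<Rightarrow> 'v \<Rightarrow> bool" where "on f x \<longleftrightarrow> (\<exists>y. inc f x y)"

lemma adj_sym: "adj x y \<Longrightarrow> adj y x"
  by (auto simp: adj_def intro: inc_sym)

lemma adjI: "inc f x y \<Longrightarrow> adj x y"
  by (auto simp: adj_def)

lemma onI: "inc f x y \<Longrightarrow> on f x" "inc f x y \<Longrightarrow> on f y"
  by (auto simp: on_def intro: inc_sym)

lemma inc_third: "\<lbrakk>inc f x y; inc f x z; y \<noteq> z; inc f x w\<rbrakk> \<Longrightarrow> w = y \<or> w = z"
  by (metis corner)

lemma face_third: "\<lbrakk>inc f x y; inc g x y; f \<noteq> g; inc h x y\<rbrakk> \<Longrightarrow> h = f \<or> h = g"
  by (metis two_faces)

lemma on_both: "\<lbrakk>f \<noteq> g; on f x; on g x; on f y; on g y; x \<noteq> y\<rbrakk> \<Longrightarrow> inc f x y"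
  unfolding on_def using faces_meet by metis

lemma on_both_third:
  "\<lbrakk>f \<noteq> g; on f x; on g x; on f y; on g y; x \<noteq> y; on f z; on g z\<rbrakk> \<Longrightarrow> z = x \<or> z = y"
  unfolding on_def using faces_meet by metis

text \<open>Otherwise \<open>x\<close>, \<open>y\<close>, \<open>z\<close> would be three common
  vertices of two distinct faces, which share at most the two ends of one edge.\<close>

lemma same_face: "\<lbrakk>inc f x y; inc f x z; inc g x y; inc g x z; y \<noteq> z\<rbrakk> \<Longrightarrow> f = g"
  by (metis on_both_third onI inc_neq)

lemma nbrs_finite: "adj x a \<Longrightarrow> finite {z. adj x z}"
  using four_neighbours unfolding adj_def by (metis card.infinite zero_neq_numeral)

lemma nbrs_card: "adj x a \<Longrightarrow> card {z. adj x z} = 4"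
  using four_neighbours unfolding adj_def by blast

text \<open>The form in which degree 4 enters the counting arguments: four known neighbours leave no
  room for a fifth.\<close>

lemma nbrs_eq:
  assumes "adj x a" "adj x b" "adj x c" "adj x d" "distinct [a, b, c, d]" "adj x e"
  shows "e = a \<or> e = b \<or> e = c \<or> e = d"
proof -
  have "card {a,b,c,d} = 4" using assms(5) by auto
  then have "{a,b,c,d} = {z. adj x z}"
    using assms by (intro card_subset_eq) (auto simp: nbrs_card intro: nbrs_finite)
  then show ?thesis using assms(6) by blast
qed

text \<open>Produces the cyclic order \<open>p\<close>, \<open>a\<close>, \<open>b\<close>,
  \<open>q\<close> of the neighbours of \<open>x\<close>, with the faces \<open>g\<close>,
  \<open>h\<close>, \<open>k\<close>, \<open>f\<close> in the gaps. Crossing the edges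
  \<open>xp\<close> and \<open>xq\<close> away from \<open>f\<close> gives \<open>g\<close> and
  \<open>k\<close>, whose other edges at \<open>x\<close> end in \<open>a\<close> and
  \<open>b\<close>. If \<open>a = b\<close>, the three faces \<open>f\<close>, \<open>g\<close>,
  \<open>k\<close> would close up around \<open>p\<close>, \<open>a\<close>, \<open>q\<close>; a
  face through the fourth edge could use none of these saturated edges, so its second edge would
  give a fifth neighbour.\<close>

lemma frame:
  assumes p: "inc f x p" and q: "inc f x q" and pq: "p \<noteq> q"
  obtains a b g h k where "distinct [p, q, a, b]" "distinct [f, g, h, k]"
    "inc g x p" "inc g x a" "inc h x a" "inc h x b" "inc k x b" "inc k x q"
proof -
  obtain g where g: "g \<noteq> f" "inc g x p" using two_faces[OF p] by blast
  obtain k where k: "k \<noteq> f" "inc k x q" using two_faces[OF q] by blast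
  obtain a where a: "a \<noteq> p" "inc g x a" using corner[OF g(2)] by blast
  obtain b where b: "b \<noteq> q" "inc k x b" using corner[OF k(2)] by blast
  have aq: "a \<noteq> q" using same_face[of f x p q g] assms g a by auto
  have bp: "b \<noteq> p" using same_face[of f x p q k] assms k b by auto
  have fa: "\<not> inc f x a" using inc_third[OF p q pq] a aq by blast
  have fb: "\<not> inc f x b" using inc_third[OF p q pq] b bp by blast
  have gk: "g \<noteq> k" using inc_third[OF a(2) g(2) a(1), of q] k aq pq by auto
  have ab: "a \<noteq> b"
  proof
    assume eq: "a = b"
    have "\<exists>d. adj x d \<and> d \<notin> {p,q,a}"
    proof (rule ccontr)
      assume "\<not> ?thesis"
      then have "{z. adj x z} \<subseteq> {p,q,a}" by blast
      then have "card {z. adj x z} \<le> card {p,q,a}" by (intro card_mono) auto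
      also have "\<dots> \<le> 3" by (simp add: card_insert_if)
      finally show False using nbrs_card[OF adjI[OF p]] by simp
    qed
    then obtain d h where d: "inc h x d" "d \<notin> {p,q,a}" by (auto simp: adj_def)
    obtain e where e: "e \<noteq> d" "inc h x e" using corner[OF d(1)] by blast
    have hf: "h \<noteq> f" using inc_third[OF p q pq, of d] d by auto
    have hg: "h \<noteq> g" using inc_third[OF g(2) a(2), of d] d a by auto
    have hk: "h \<noteq> k" using inc_third[OF k(2) b(2), of d] d b eq by auto
    have "e \<noteq> p" using face_third[of g x p f h] g p e hf hg by auto
    moreover have "e \<noteq> q" using face_third[of k x q f h] k q e hf hk by auto
    moreover have "e \<noteq> a" using face_third[of k x a g h] b a eq gk e hg hk by auto
    ultimately have dis: "distinct [p,q,a,d]" "e \<notin> {p,q,a,d}" using d e pq a aq by auto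
    show False
      using nbrs_eq[OF adjI[OF p] adjI[OF q] adjI[OF a(2)] adjI[OF d(1)] dis(1) adjI[OF e(2)]] dis(2)
      by auto
  qed
  obtain h where h: "h \<noteq> g" "inc h x a" using two_faces[OF a(2)] by blast
  obtain c where c: "c \<noteq> a" "inc h x c" using corner[OF h(2)] by blast
  have hf: "h \<noteq> f" using fa h by auto
  have "c \<noteq> p" using face_third[of g x p f h] g p c hf h by auto
  have hk: "h \<noteq> k" using inc_third[OF k(2) b(2), of a] b ab aq h by auto
  have "c \<noteq> q" using face_third[of k x q f h] k q c hf hk by auto
  have dis: "distinct [p,q,a,b]" using pq a aq ab b bp by auto
  have "c = b"
    using nbrs_eq[OF adjI[OF p] adjI[OF q] adjI[OF a(2)] adjI[OF b(2)] dis adjI[OF c(2)]]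
      \<open>c \<noteq> p\<close> \<open>c \<noteq> q\<close> c by auto
  then show thesis using that[OF dis, of g h k] g k a b h c hf hk gk by auto
qed

lemma faces_of_frame:
  assumes "inc f x p" "inc f x q" "distinct [p, q, a, b]" "distinct [f, g, h, k]"
    "inc g x p" "inc g x a" "inc h x a" "inc h x b" "inc k x b" "inc k x q" "inc l x y"
  shows "l \<in> {f, g, h, k}"
proof -
  have "y \<in> {p,q,a,b}" using nbrs_eq[of x p q a b y] assms adjI by auto
  then show ?thesis
    using face_third[of f x p g l] face_third[of f x q k l] face_third[of g x a h l]
      face_third[of h x b k l] assms by auto
qed


end

section \<open>Triangles and squares around a face of degree at least 8\<close>

locale four_regular_map_with_large_faces = four_regular_map inc
  for inc :: "'f \<Rightarrow> 'v \<Rightarrow> 'v \<Rightarrow> bool" +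
  fixes deg :: "'f \<Rightarrow> nat"
  assumes triangle: "\<lbrakk>deg f = 3; inc f x y; inc f x z; y \<noteq> z\<rbrakk> \<Longrightarrow> inc f y z"
    and square: "\<lbrakk>deg f = 4; inc f x y; inc f x z; y \<noteq> z\<rbrakk>
      \<Longrightarrow> \<exists>w. w \<noteq> x \<and> w \<noteq> y \<and> w \<noteq> z \<and> inc f y w \<and> inc f z w"
    and big_vertex: "\<lbrakk>deg s \<ge> 8; inc s x u; inc f x v; f \<noteq> s\<rbrakk> \<Longrightarrow> deg f = 3 \<or> deg f = 4"
    and big_vertex_square: "\<lbrakk>deg s \<ge> 8; inc s x u; inc f x v; f \<noteq> s; inc g x w; g \<noteq> s; f \<noteq> g; deg f = 4\<rbrakk>
      \<Longrightarrow> deg g = 3"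
begin

definition tip :: "'f \<Rightarrow> 'v \<Rightarrow> bool" where
  "tip s y \<longleftrightarrow> \<not> on s y \<and> (\<exists>f x x'. f \<noteq> s \<and> deg f = 3 \<and> inc s x x' \<and> inc f x x' \<and> inc f x y \<and> inc f x' y)"

lemma no_five_neighbours:
  assumes "adj x a" "adj x b" "adj x c" "adj x d" "adj x e" "distinct [a, b, c, d, e]"
  shows False
  using nbrs_eq[of x a b c d e] assms by auto

lemma two_on_face:
  assumes "on s x"
  obtains p q where "inc s x p" "inc s x q" "p \<noteq> q"
  using assms corner unfolding on_def by metis

text \<open>Two of the four edges at a tip lead to the face; the neighbour counts below exploit
  this.\<close>

lemma tip_neighbours:
  assumes "tip s y"
  obtains x x' where "inc s x x'" "on s x" "on s x'" "x \<noteq> x'" "adj y x" "adj y x'" "\<not> on s y"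
  using assms unfolding tip_def by (metis adjI inc_neq inc_sym onI)

text \<open>The apex \<open>y\<close> cannot lie on \<open>s\<close>, because \<open>f\<close> and
  \<open>s\<close> already share the two vertices \<open>x\<close> and \<open>p\<close>.\<close>

lemma tipI:
  assumes "f \<noteq> s" "deg f = 3" "inc s x p" "inc f x p" "inc f x y" "y \<noteq> p"
  shows "tip s y"
proof -
  have py: "inc f p y" using triangle[of f x p y] assms by blast
  have "\<not> on s y" using on_both_third[of f s x p y] assms inc_neq onI by metis
  then show ?thesis unfolding tip_def using assms py by blast
qed

text \<open>At a vertex of \<open>s\<close> every other face has degree 3 or 4, which excludes
  \<open>t\<close>.\<close>

lemma big_disjoint: "\<lbrakk>deg s \<ge> 8; deg t \<ge> 8; s \<noteq> t; on s x\<rbrakk> \<Longrightarrow> \<not> on t x"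
  using big_vertex[of s x _ t] unfolding on_def by fastforce

text \<open>This is \<open>frame\<close> at a vertex of \<open>s\<close>, reflected if necessary so
  that the given neighbour \<open>a\<close> off \<open>s\<close> is met first. The faces
  \<open>A\<close> and \<open>C\<close> lie beside \<open>s\<close> and \<open>B\<close> lies
  opposite; at most one of the three is a square. A neighbour \<open>b\<close> on \<open>s\<close>
  would give \<open>s\<close> a third edge at \<open>x\<close>.\<close>

lemma big_frame:
  assumes s: "deg s \<ge> 8" and x: "on s x" and a: "adj x a" and na: "\<not> on s a"
  obtains p q b A B C where "inc s x p" "inc s x q" "distinct [p, q, a, b]" "distinct [s, A, B, C]"
    "inc A x p" "inc A x a" "inc B x a" "inc B x b" "inc C x b" "inc C x q" "\<not> on s b"
    "deg A = 3 \<or> deg A = 4" "deg B = 3 \<or> deg B = 4" "deg C = 3 \<or> deg C = 4"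
    "deg A = 4 \<Longrightarrow> deg B = 3 \<and> deg C = 3" "deg B = 4 \<Longrightarrow> deg A = 3 \<and> deg C = 3"
    "deg C = 4 \<Longrightarrow> deg A = 3 \<and> deg B = 3"
proof -
  note goal = that
  have main: thesis if f: "inc s x p" "inc s x q" "distinct [p, q, a, b]" "distinct [s, A, B, C]"
    "inc A x p" "inc A x a" "inc B x a" "inc B x b" "inc C x b" "inc C x q" for p q b A B C
  proof -
    have "\<not> on s b"
    proof
      assume "on s b"
      then have "inc s x b" using on_both[of s C x b] f x onI inc_neq by (metis distinct_length_2_or_more)
      then show False using inc_third[of s x p q b] f by auto
    qed
    moreover have "deg A = 3 \<or> deg A = 4" "deg B = 3 \<or> deg B = 4" "deg C = 3 \<or> deg C = 4"
      using big_vertex[OF s f(1)] f by auto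
    moreover have "deg A = 4 \<Longrightarrow> deg B = 3 \<and> deg C = 3" "deg B = 4 \<Longrightarrow> deg A = 3 \<and> deg C = 3"
      "deg C = 4 \<Longrightarrow> deg A = 3 \<and> deg B = 3"
      using big_vertex_square[OF s f(1)] f by auto
    ultimately show thesis using goal f by blast
  qed
  obtain p q where pq: "inc s x p" "inc s x q" "p \<noteq> q" using two_on_face[OF x] .
  obtain a' b' A B C where f: "distinct [p, q, a', b']" "distinct [s, A, B, C]"
    "inc A x p" "inc A x a'" "inc B x a'" "inc B x b'" "inc C x b'" "inc C x q"
    using frame[OF pq] .
  have "a = a' \<or> a = b'"
    using nbrs_eq[of x p q a' b' a] pq f adjI a na onI by metis
  then show thesis
  proof
    assume "a = a'"
    then show thesis using main[of p q b' A B C] pq f by auto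
  next
    assume "a = b'"
    then show thesis using main[of q p a' C B A] pq f by auto
  qed
qed

text \<open>
  If \<open>y\<close> is not a tip, the face \<open>xyc\<close> next to \<open>s\<close> is a square; it uses up the only square
  allowed at \<open>x\<close>, so the other faces at \<open>x\<close> are triangles and the last neighbour \<open>b\<close> of \<open>x\<close> is a tip.
\<close>

lemma single_contact:
  assumes s: "deg s \<ge> 8" and x: "on s x" and y: "\<not> on s y" "adj y x" and nt: "\<not> tip s y"
  obtains b c u where "adj y b" "adj x b" "tip s b" "adj y c" "on s u" "adj c u" "\<not> on s c" "b \<noteq> c"
proof -
  obtain p q b A B C where f: "inc s x p" "inc s x q" "distinct [p, q, y, b]" "distinct [s, A, B, C]"
    "inc A x p" "inc A x y" "inc B x y" "inc B x b" "inc C x b" "inc C x q" "\<not> on s b"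
    "deg A = 3 \<or> deg A = 4" "deg A = 4 \<Longrightarrow> deg B = 3 \<and> deg C = 3"
    using big_frame[OF s x adj_sym[OF y(2)] y(1)] by metis
  have "deg A \<noteq> 3" using tipI[of A s x p y] f nt by auto
  then have d: "deg A = 4" "deg B = 3" "deg C = 3" using f by auto
  obtain c where c: "c \<noteq> x" "c \<noteq> p" "c \<noteq> y" "inc A p c" "inc A y c"
    using square[of A x p y] d f by auto
  have yb: "inc B y b" using triangle[of B x y b] d f by auto
  have tb: "tip s b" using tipI[of C s x q b] f d by auto
  have "b \<noteq> c" using same_face[of A y x c B] f c yb inc_sym by auto
  moreover have "\<not> on s c" using on_both_third[of A s x p c] f c inc_neq onI by (metis distinct_length_2_or_more)
  ultimately show thesis
    using that[of b c p] yb tb f c adjI adj_sym onI by blast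
qed

text \<open>
  The last two alternatives cover a zigzag of squares between \<open>s\<close> and \<open>t\<close>, whose vertices are
  adjacent to only one of the two faces.
\<close>

definition mid :: "'f \<Rightarrow> 'f \<Rightarrow> 'v \<Rightarrow> bool" where
  "mid s t y \<longleftrightarrow> \<not> on s y \<and> \<not> on t y \<and>
     ((\<exists>x z. adj y x \<and> on s x \<and> adj y z \<and> on t z) \<or>
      tip s y \<and> (\<exists>w. adj y w \<and> tip t w \<and> \<not> on s w) \<or>
      tip t y \<and> (\<exists>w. adj y w \<and> tip s w \<and> \<not> on t w))"

definition rim :: "'f \<Rightarrow> 'f \<Rightarrow> 'v \<Rightarrow> bool" where
  "rim s t x \<longleftrightarrow> on s x \<and> (\<exists>y. adj x y \<and> (on t y \<or> mid s t y))"

definition band :: "'f \<Rightarrow> 'f \<Rightarrow> 'v \<Rightarrow> bool" where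
  "band s t v \<longleftrightarrow> rim s t v \<or> rim t s v \<or> mid s t v"

lemma mid_commute: "mid s t y \<longleftrightarrow> mid t s y"
  unfolding mid_def by blast

lemma band_commute: "band s t y \<longleftrightarrow> band t s y"
  unfolding band_def using mid_commute by blast

text \<open>Used for finiteness: every vertex of the band is within distance one of \<open>s\<close>
  or \<open>t\<close>.\<close>

lemma band_near:
  assumes "band s t v"
  shows "on s v \<or> on t v \<or> (\<exists>x. (on s x \<or> on t x) \<and> adj v x)"
proof -
  have tip: "\<exists>x. on r x \<and> adj v x" if t: "tip r v" for r
    using tip_neighbours[OF t] by metis
  have "on s v \<or> on t v \<or> mid s t v" using assms unfolding band_def rim_def by blast
  moreover have "(\<exists>x. on s x \<and> adj v x) \<or> (\<exists>x. on t x \<and> adj v x)" if "mid s t v"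
    using that tip[of s] tip[of t] unfolding mid_def by meson
  ultimately show ?thesis by blast
qed

lemma tip_not_on: "tip s y \<Longrightarrow> \<not> on s y"
  by (simp add: tip_def)

section \<open>Vertices in contact with two large faces\<close>

context
  fixes s t assumes s: "deg s \<ge> 8" and t: "deg t \<ge> 8" and st: "s \<noteq> t"
begin

text \<open>Two edges at \<open>y\<close> go to \<open>s\<close> and two to \<open>t\<close>. The
  four ends are distinct because the faces share no vertex, so no edge is left over.\<close>

lemma tips_neighbour:
  assumes "tip s y" "tip t y" "adj y w" shows "on s w \<or> on t w"
proof -
  obtain x x' where x: "on s x" "on s x'" "x \<noteq> x'" "adj y x" "adj y x'"
    using tip_neighbours[OF assms(1)] .
  obtain z z' where z: "on t z" "on t z'" "z \<noteq> z'" "adj y z" "adj y z'"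
    using tip_neighbours[OF assms(2)] .
  have "distinct [x,x',z,z']" using x z big_disjoint[OF s t st] by auto
  then show ?thesis using nbrs_eq[of y x x' z z' w] x z assms(3) by blast
qed

text \<open>The same count as for a common tip, with the two boundary edges of \<open>s\<close> at
  \<open>y\<close> in place of the edges of a triangle.\<close>

lemma on_tip_neighbour:
  assumes "on s y" "tip t y" "adj y w" shows "on s w \<or> on t w"
proof -
  obtain x x' where x: "inc s y x" "inc s y x'" "x \<noteq> x'"
    using two_on_face[OF assms(1)] .
  obtain z z' where z: "on t z" "on t z'" "z \<noteq> z'" "adj y z" "adj y z'"
    using tip_neighbours[OF assms(2)] .
  have xs: "on s x" "on s x'" using x onI by blast+
  then have "distinct [x,x',z,z']" using x z big_disjoint[OF s t st] by auto
  then show ?thesis using nbrs_eq[of y x x' z z' w] x z xs assms(3) adjI by blast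
qed

text \<open>Adds to \<open>single_contact\<close> that the tip \<open>b\<close> of \<open>t\<close>
  is off \<open>s\<close>: a tip of \<open>t\<close> on \<open>s\<close> has all its neighbours on
  \<open>s\<close> or \<open>t\<close>, but \<open>y\<close> is a neighbour of \<open>b\<close> off
  both.\<close>

lemma single_contact_outside:
  assumes z: "on t z" and y: "\<not> on t y" "\<not> on s y" "adj y z" and nt: "\<not> tip t y"
  obtains b c u where "adj y b" "adj z b" "tip t b" "\<not> on s b" "adj y c" "on t u" "adj c u" "\<not> on t c" "b \<noteq> c"
proof -
  obtain b c u where b: "adj y b" "adj z b" "tip t b" "adj y c" "on t u" "adj c u" "\<not> on t c" "b \<noteq> c"
    using single_contact[OF t z y(1) y(3) nt] .
  have "\<not> on s b" using on_tip_neighbour[of b y] b y adj_sym by blast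
  then show thesis using that b by blast
qed

text \<open>The neighbours of \<open>y\<close> are two vertices of \<open>s\<close>, the vertex
  \<open>z\<close> of \<open>t\<close> and the tip \<open>b\<close> of \<open>t\<close> supplied by
  the single contact with \<open>t\<close>. Only \<open>b\<close> can be off both faces.\<close>

lemma tip_contact_neighbour:
  assumes y: "\<not> on s y" "\<not> on t y" and ty: "tip s y" and z: "adj y z" "on t z" and nt: "\<not> tip t y"
    and w: "adj y w" "\<not> on s w" "\<not> on t w"
  shows "tip t w"
proof -
  obtain b where b: "adj y b" "tip t b" "\<not> on s b"
    using single_contact_outside[OF z(2) y(2,1) z(1) nt] by metis
  obtain x x' where x: "on s x" "on s x'" "x \<noteq> x'" "adj y x" "adj y x'"
    using tip_neighbours[OF ty] .
  have "distinct [x,x',z,b]" using x z b big_disjoint[OF s t st] tip_not_on by auto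
  then have "w = b" using nbrs_eq[of y x x' z b w] x z b w by blast
  then show ?thesis using b by simp
qed

end

text \<open>Otherwise the neighbours of \<open>y\<close> are \<open>x\<close>, \<open>z\<close>, a
  tip \<open>b\<close> of \<open>s\<close> and a tip \<open>b'\<close> of \<open>t\<close>. The far
  corner \<open>c\<close> of the square beside \<open>s\<close> is also a neighbour of
  \<open>y\<close>, hence \<open>z\<close> or \<open>b'\<close>. If \<open>c = b'\<close>, then
  \<open>b'\<close> is a tip of \<open>t\<close> touching \<open>s\<close>, and
  \<open>tip_contact_neighbour\<close> with the faces exchanged makes \<open>y\<close> a tip of
  \<open>s\<close>. If \<open>c = z\<close>, then \<open>z\<close> has five neighbours.\<close>

lemma not_both_single:
  assumes s: "deg s \<ge> 8" and t: "deg t \<ge> 8" and st: "s \<noteq> t"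
    and y: "\<not> on s y" "\<not> on t y" and x: "adj y x" "on s x" and z: "adj y z" "on t z"
  shows "tip s y \<or> tip t y"
proof (rule ccontr)
  assume "\<not> ?thesis"
  then have n: "\<not> tip s y" "\<not> tip t y" by auto
  have ts: "t \<noteq> s" using st by simp
  obtain b c u where b: "adj y b" "adj x b" "tip s b" "\<not> on t b" "adj y c" "on s u" "adj c u" "\<not> on s c" "b \<noteq> c"
    using single_contact_outside[OF t s ts x(2) y x(1) n(1)] .
  obtain b' where b': "adj y b'" "adj z b'" "tip t b'" "\<not> on s b'"
    using single_contact_outside[OF s t st z(2) y(2,1) z(1) n(2)] by metis
  have "b \<noteq> b'" using tips_neighbour[OF s t st, of b y] b b' y adj_sym by blast
  then have "distinct [x,z,b,b']" using x z b b' big_disjoint[OF s t st] tip_not_on by auto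
  then have "c = z \<or> c = b'" using nbrs_eq[of y x z b b' c] x z b b' by blast
  then show False
  proof
    assume "c = b'"
    then have "tip s y" 
      using tip_contact_neighbour[OF t s ts, of b' u y] b b' y n tips_neighbour[OF s t st, of b' y] tip_not_on adj_sym by blast
    then show False using n by simp
  next
    assume "c = z"
    obtain p q where pq: "inc t z p" "inc t z q" "p \<noteq> q" using two_on_face[OF z(2)] .
    have "distinct [u, y, b', p, q]"
      using pq b b' y onI big_disjoint[OF s t st] tip_not_on n by (metis (full_types) distinct_length_2_or_more distinct_singleton)
    then show False using no_five_neighbours[of z u y b' p q] pq b b' z \<open>c = z\<close> adjI adj_sym by blast
  qed
qed

text \<open>The face \<open>k\<close> carries the path \<open>x\<close>, \<open>y\<close>,
  \<open>w\<close>, \<open>z\<close> of four distinct vertices, so it is a square and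
  \<open>x\<close>, \<open>z\<close> are adjacent. It is the face opposite \<open>s\<close> at
  \<open>x\<close>, hence the face \<open>A\<close> beside \<open>s\<close> is a triangle and joins
  \<open>z\<close> to a second vertex \<open>p\<close> of \<open>s\<close>. With \<open>w\<close>
  and its two neighbours on \<open>t\<close>, the vertex \<open>z\<close> then has five
  neighbours.\<close>

lemma crossed_tips_off:
  assumes s: "deg s \<ge> 8" and t: "deg t \<ge> 8" and st: "s \<noteq> t"
    and x: "on s x" and y: "\<not> on s y" "\<not> on t y" and w: "\<not> on s w" "\<not> on t w" and z: "on t z"
    and k: "inc k x y" "inc k y w" "inc k w z"
  shows False
proof -
  have ks: "k \<noteq> s" and kt: "k \<noteq> t" using y k onI by blast+
  have dis: "x \<noteq> w" "x \<noteq> z" "y \<noteq> z" using x y z w big_disjoint[OF s t st] by blast+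
  have "deg k = 3 \<or> deg k = 4" using big_vertex[OF s _ k(1) ks] x unfolding on_def by blast
  moreover have "deg k \<noteq> 3"
    using triangle[of k y w x] inc_third[of k w y x z] k dis inc_sym inc_neq by metis
  ultimately have d: "deg k = 4" by simp
  obtain v where v: "v \<noteq> y" "inc k w v" "inc k x v"
    using square[of k y w x] d k inc_sym dis by metis
  have "v = z" using inc_third[of k w y z v] v k inc_sym dis by blast
  then have xz: "inc k x z" using v by simp
  have zs: "\<not> on s z" using z big_disjoint[OF s t st] by blast
  obtain p q b A B C where f: "inc s x p" "inc s x q" "distinct [p, q, z, b]" "distinct [s, A, B, C]"
    "inc A x p" "inc A x z" "inc B x z" "inc B x b" "inc C x b" "inc C x q" "\<not> on s b"
    "deg B = 4 \<Longrightarrow> deg A = 3 \<and> deg C = 3"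
    using big_frame[OF s x adjI[OF xz] zs] by metis
  have "y = b" using nbrs_eq[of x p q z b y] f adjI k y dis onI(2) by metis
  then have "k = B" using same_face[of k x y z B] k f xz dis by auto
  then have "inc A p z" using triangle[of A x p z] f d by auto
  obtain r1 r2 where r: "inc t z r1" "inc t z r2" "r1 \<noteq> r2" using two_on_face[OF z] .
  have "on s p" "on t r1" "on t r2" "x \<noteq> p" using f r onI inc_neq by blast+
  then have "distinct [x, p, w, r1, r2]"
    using x w r big_disjoint[OF s t st] by auto
  then show False
    using no_five_neighbours[of z x p w r1 r2] xz \<open>inc A p z\<close> k r adjI inc_sym by blast
qed

text \<open>Since \<open>y\<close> and \<open>z\<close> are not adjacent, \<open>h\<close> is a
  square with corners \<open>z\<close>, \<open>w\<close>, \<open>y\<close>, \<open>a\<close>. Both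
  \<open>w\<close> and \<open>a\<close> are off \<open>t\<close>, so \<open>h\<close> is the face
  opposite \<open>t\<close> at \<open>z\<close>; the faces beside \<open>t\<close> are then
  triangles, and \<open>a\<close> is the apex of one.\<close>

lemma tip_across_square:
  assumes t: "deg t \<ge> 8" and z: "on t z" and w: "\<not> on t w" and y: "\<not> on t y" and a: "\<not> on t a"
    and h: "inc h z w" "inc h w y" "inc h y a" "y \<noteq> z" "a \<noteq> w" and yz: "\<not> adj y z"
  shows "tip t a"
proof -
  have ht: "h \<noteq> t" using w h onI by blast
  have "deg h = 3 \<or> deg h = 4" using big_vertex[OF t _ h(1) ht] z unfolding on_def by blast
  moreover have "deg h \<noteq> 3"
    using triangle[of h w y z] h inc_sym yz adjI by metis
  ultimately have d: "deg h = 4" by simp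
  obtain v where v: "v \<noteq> w" "inc h y v" "inc h z v"
    using square[of h w y z] d h inc_sym by metis
  have "v = a" using inc_third[of h y w a v] v h inc_sym by blast
  then have za: "inc h z a" using v by simp
  obtain p q b A B C where f: "inc t z p" "inc t z q" "distinct [p, q, a, b]" "distinct [t, A, B, C]"
    "inc A z p" "inc A z a" "inc B z a" "inc B z b" "inc C z b" "inc C z q" "\<not> on t b"
    "deg B = 4 \<Longrightarrow> deg A = 3 \<and> deg C = 3"
    using big_frame[OF t z adjI[OF za] a] by metis
  have "w = b" using nbrs_eq[of z p q a b w] f adjI h w onI(2) by metis
  then have "h = B" using same_face[of h z w a B] h f za by auto
  then show ?thesis using tipI[of A t z p a] f d by auto
qed

text \<open>Two consecutive edges at \<open>w\<close> lead to \<open>t\<close>, so one of the two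
  faces along \<open>yw\<close> has an edge from \<open>w\<close> to \<open>t\<close>. It cannot be
  \<open>k\<close>, by \<open>crossed_tips_off\<close>; hence it is \<open>h\<close>, and
  \<open>tip_across_square\<close> applies.\<close>

lemma tip_chain_step:
  assumes s: "deg s \<ge> 8" and t: "deg t \<ge> 8" and st: "s \<noteq> t"
    and y: "\<not> on s y" "\<not> on t y" and w: "\<not> on s w" "tip t w" and x: "on s x"
    and faces: "inc h y a" "inc h y w" "inc k y w" "inc k y x" "h \<noteq> k" "a \<noteq> w"
    and far: "\<And>z. adj y z \<Longrightarrow> \<not> on t z"
  shows "tip t a"
proof -
  have wt: "\<not> on t w" using w tip_not_on by blast
  obtain T z z' where T: "T \<noteq> t" "inc t z z'" "inc T z z'" "inc T z w" "inc T z' w"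
    using w(2) unfolding tip_def by blast
  have zz: "on t z" "on t z'" "z \<noteq> z'" using T onI inc_neq by blast+
  obtain c d g' h' k' where f: "distinct [z, z', c, d]" "distinct [T, g', h', k']"
    "inc g' w z" "inc g' w c" "inc h' w c" "inc h' w d" "inc k' w d" "inc k' w z'"
    using frame[of T w z z'] T zz inc_sym by metis
  have wy: "adj w y" using faces adjI adj_sym by blast
  have "y = c \<or> y = d"
    using nbrs_eq[of w z z' c d y] f adjI wy zz y by metis
  \<comment> \<open>Here \<open>z0\<close> is the one of \<open>z\<close>, \<open>z'\<close> next to
    \<open>y\<close> in the cyclic order around \<open>w\<close>, and \<open>k0\<close> is the face
    between \<open>wy\<close> and \<open>wz0\<close>.\<close>
  then obtain z0 k0 h0 where k0: "on t z0" "inc k0 w z0" "inc k0 w y" "inc h0 w y" "h0 \<noteq> k0"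
    using f zz by auto
  have "k0 = h \<or> k0 = k" using face_third[of h w y k k0] faces k0 inc_sym by blast
  then show ?thesis
  proof
    assume "k0 = k"
    then show ?thesis using crossed_tips_off[OF s t st x y w(1) wt k0(1), of k] faces k0 inc_sym by blast
  next
    assume "k0 = h"
    then show ?thesis
      using tip_across_square[OF t k0(1) wt y(2), of a h] faces k0 y far adjI inc_sym by blast
  qed
qed

text \<open>Around \<open>y\<close> the order is \<open>x\<close>, \<open>a\<close>,
  \<open>b\<close>, \<open>x'\<close> with \<open>x\<close>, \<open>x'\<close> on \<open>s\<close>.
  Both \<open>w\<close> and \<open>v\<close> lie in {\<open>a\<close>, \<open>b\<close>}, so if they
  differ they share the face \<open>h\<close>, while the other face along \<open>yw\<close> reaches
  \<open>s\<close>. This is the situation of \<open>tip_chain_step\<close>.\<close>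

lemma tip_chain:
  assumes s: "deg s \<ge> 8" and t: "deg t \<ge> 8" and st: "s \<noteq> t"
    and y: "\<not> on t y" "tip s y" and w: "\<not> on s w" "tip t w" "adj y w"
    and far: "\<And>z. adj y z \<Longrightarrow> \<not> on t z" and v: "adj y v" "\<not> on s v"
  shows "tip t v"
proof -
  have ys: "\<not> on s y" using y tip_not_on by blast
  obtain T x x' where T: "inc s x x'" "inc T x y" "inc T x' y"
    using y(2) unfolding tip_def by blast
  have xx: "on s x" "on s x'" "x \<noteq> x'" using T onI inc_neq by blast+
  obtain a b g h k where f: "distinct [x, x', a, b]" "distinct [T, g, h, k]"
    "inc g y x" "inc g y a" "inc h y a" "inc h y b" "inc k y b" "inc k y x'"
    using frame[of T y x x'] T xx inc_sym by metis
  have wab: "w = a \<or> w = b"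
    using nbrs_eq[of y x x' a b w] f adjI w xx by metis
  have vab: "v = a \<or> v = b"
    using nbrs_eq[of y x x' a b v] f adjI v xx by metis
  show ?thesis
  proof (cases "v = w")
    case False
    then show ?thesis
      using wab vab tip_chain_step[OF s t st ys y(1) w(1,2) xx(1), of h v g]
        tip_chain_step[OF s t st ys y(1) w(1,2) xx(2), of h v k] f far by auto
  qed (use w in simp)
qed

text \<open>Whether or not \<open>y\<close> has a neighbour on \<open>t\<close>, the vertex
  \<open>v\<close> turns out to be a tip of \<open>t\<close>; with the tip \<open>y\<close> of
  \<open>s\<close> it forms an adjacent pair of tips. If \<open>y\<close> does touch
  \<open>t\<close>, it is not itself a tip of \<open>t\<close>, since a common tip has no neighbour
  off both faces.\<close>

lemma mid_neighbour_tip: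
  assumes s: "deg s \<ge> 8" and t: "deg t \<ge> 8" and st: "s \<noteq> t"
    and y: "\<not> on s y" "\<not> on t y" "tip s y" and v: "adj y v" "\<not> on s v" "\<not> on t v"
    and m: "(\<exists>z. adj y z \<and> on t z) \<or> (\<exists>w. adj y w \<and> tip t w \<and> \<not> on s w)"
  shows "mid s t v"
proof -
  have "\<not> tip t y \<or> \<not> (\<exists>z. adj y z \<and> on t z)" 
    using tips_neighbour[OF s t st y(3) _ v(1)] v by blast
  then have "tip t v"
    using m tip_contact_neighbour[OF s t st y _ _ _ v] tip_chain[OF s t st y(2,3) _ _ _ _ v(1,2)] by metis
  then show ?thesis using v y adj_sym unfolding mid_def by blast
qed

text \<open>Every middle vertex is a tip of \<open>s\<close> or of \<open>t\<close>, by definition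
  or by \<open>not_both_single\<close>; up to exchanging the faces, \<open>mid_neighbour_tip\<close>
  applies.\<close>

lemma mid_neighbour_mid:
  assumes s: "deg s \<ge> 8" and t: "deg t \<ge> 8" and st: "s \<noteq> t"
    and m: "mid s t y" and v: "adj y v" "\<not> on s v" "\<not> on t v"
  shows "mid s t v"
proof -
  have y: "\<not> on s y" "\<not> on t y" using m by (auto simp: mid_def)
  have "tip s y \<or> tip t y" 
    using m not_both_single[OF s t st y] unfolding mid_def by blast
  then show ?thesis
  proof
    assume a: "tip s y"
    have "(\<exists>z. adj y z \<and> on t z) \<or> (\<exists>w. adj y w \<and> tip t w \<and> \<not> on s w)"
      using m tip_neighbours unfolding mid_def by metis
    then show ?thesis using mid_neighbour_tip[OF s t st y a v] by blast
  next
    assume a: "tip t y"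
    have "(\<exists>z. adj y z \<and> on s z) \<or> (\<exists>w. adj y w \<and> tip s w \<and> \<not> on t w)"
      using m tip_neighbours unfolding mid_def by metis
    then show ?thesis using mid_neighbour_tip[OF t s st[symmetric] y(2,1) a v(1,3,2)] mid_commute by blast
  qed
qed

lemma mid_neighbour:
  assumes s: "deg s \<ge> 8" and t: "deg t \<ge> 8" and st: "s \<noteq> t" and m: "mid s t y" and v: "adj y v"
  shows "band s t v"
  using mid_neighbour_mid[OF s t st m v] adj_sym[OF v] m
  unfolding band_def rim_def mid_commute[of t s] by blast

section \<open>Propagation of contact along the boundary of a large face\<close>

lemma contact_transfer:
  assumes s: "deg s \<ge> 8" and t: "deg t \<ge> 8" and st: "s \<noteq> t"
    and a: "on t a \<or> mid s t a" and c: "adj a c" "\<not> on s c" and x: "on s x" "adj c x"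
  shows "on t c \<or> mid s t c"
proof (cases "on t a")
  case True
  then show ?thesis using c x adj_sym unfolding mid_def by blast
next
  case False
  then show ?thesis using mid_neighbour[OF s t st _ c(1)] a c unfolding band_def rim_def by blast
qed

text \<open>Contact moves along \<open>s\<close> from \<open>x\<close> to \<open>p\<close> through
  the face \<open>A\<close> beside their edge. If \<open>A\<close> is a triangle, \<open>p\<close>
  is adjacent to \<open>a\<close>; if it is a square, \<open>p\<close> is adjacent to its fourth
  corner, which inherits the contact from \<open>a\<close>.\<close>

lemma rim_side:
  assumes s: "deg s \<ge> 8" and t: "deg t \<ge> 8" and st: "s \<noteq> t"
    and p: "inc s x p" "inc A x p" "A \<noteq> s" "inc A x a" "a \<noteq> p" and a: "on t a \<or> mid s t a"
  shows "rim s t p"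
proof -
  have ps: "on s p" "on s x" using p onI by blast+
  have as: "\<not> on s a" using a big_disjoint[OF s t st] unfolding mid_def by blast
  have "deg A = 3 \<or> deg A = 4" using big_vertex[OF s p(1,2,3)] .
  then show ?thesis
  proof
    assume "deg A = 3"
    then have "inc A p a" using triangle[of A x p a] p by auto
    then show ?thesis using a ps adjI unfolding rim_def by blast
  next
    assume "deg A = 4"
    then obtain c where c: "c \<noteq> x" "c \<noteq> p" "inc A p c" "inc A a c" using square[of A x p a] p by auto
    have "\<not> on s c" using on_both_third[of A s x p c] p c inc_neq onI by metis
    then have "on t c \<or> mid s t c"
      using contact_transfer[OF s t st a _ _ ps(1)] c adjI adj_sym by blast
    then show ?thesis using c ps adjI unfolding rim_def by blast
  qed
qed

text \<open>Contact passes from one outer neighbour of \<open>x\<close> to the other through the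
  opposite face \<open>B\<close>. If \<open>B\<close> is a triangle, \<open>a\<close> and
  \<open>b\<close> are adjacent. If it is a square with fourth corner \<open>c\<close>, then
  \<open>A\<close> and \<open>C\<close> are triangles, so \<open>a\<close> and \<open>b\<close> are
  tips of \<open>s\<close>, and the contact has to go around through \<open>c\<close>.\<close>

lemma rim_across:
  assumes s: "deg s \<ge> 8" and t: "deg t \<ge> 8" and st: "s \<noteq> t" and x: "on s x"
    and f: "inc s x p" "inc s x q" "distinct [p, q, a, b]" "distinct [s, A, B, C]"
    "inc A x p" "inc A x a" "inc B x a" "inc B x b" "inc C x b" "inc C x q" "\<not> on s b"
    "deg B = 3 \<or> deg B = 4" "deg B = 4 \<Longrightarrow> deg A = 3 \<and> deg C = 3"
    and a: "on t a \<or> mid s t a"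
  shows "on t b \<or> mid s t b"
  using f(12)
proof
  assume "deg B = 3"
  then have "inc B a b" using triangle[of B x a b] f by auto
  then show ?thesis using contact_transfer[OF s t st a _ f(11) x] f(8) adjI adj_sym by blast
next
  assume d: "deg B = 4"
  then have d3: "deg A = 3" "deg C = 3" using f by auto
  obtain c where c: "c \<noteq> x" "c \<noteq> a" "c \<noteq> b" "inc B a c" "inc B b c" using square[of B x a b] d f by auto
  have cs: "\<not> on s c"
  proof
    assume "on s c"
    then have "inc B x c" using on_both[of B s x c] c f x onI by (metis distinct_length_2_or_more)
    then show False using inc_third[of B x a b c] f c by auto
  qed
  have bx: "adj b x" "adj b c" "adj c b" "adj c a" using f c adjI inc_sym by blast+
  have tb: "tip s b" using tipI[of C s x q b] f d3 by auto
  have ct_done: ?thesis if "on t c"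
    using that bx x f(11) unfolding mid_def by blast
  show ?thesis
  proof (cases "on t a \<or> on t c \<or> on t b")
    case True
    \<comment> \<open>With \<open>c\<close> off \<open>t\<close>, the vertex \<open>a\<close> would
      have five neighbours: \<open>x\<close> and \<open>p\<close> on \<open>s\<close>, two vertices
      of \<open>t\<close>, and \<open>c\<close>.\<close>
    have False if ta: "on t a" and ct: "\<not> on t c"
    proof -
      have ap: "inc A p a" using triangle[of A x p a] f d3 by auto
      obtain r1 r2 where r: "inc t a r1" "inc t a r2" "r1 \<noteq> r2" using two_on_face[OF ta] .
      have "on s p" "on t r1" "on t r2" "x \<noteq> p" using f r onI inc_neq by blast+
      then have "distinct [x, p, c, r1, r2]"
        using x cs ct r big_disjoint[OF s t st] by auto
      then show False
        using no_five_neighbours[of a x p c r1 r2] ap f c r adjI inc_sym by blast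
    qed
    then show ?thesis using True ct_done by blast
  next
    case False
    then have ma: "mid s t a" and nt: "\<not> on t a" "\<not> on t c" "\<not> on t b" using a by auto
    have as: "\<not> on s a" using ma by (simp add: mid_def)
    have ta: "tip s a" using tipI[of A s x p a] f d3 by auto
    have mc: "mid s t c" using mid_neighbour_mid[OF s t st ma _ cs nt(2)] c adjI by blast
    have "tip t c \<or> tip t b"
    proof (rule ccontr)
      assume n: "\<not> ?thesis"
      have nta: "\<not> tip t a" using tips_neighbour[OF s t st ta _ adjI[OF c(4)]] cs nt by blast
      \<comment> \<open>Two neighbours \<open>u\<close>, \<open>v\<close> of \<open>c\<close> on the
        large faces, together with \<open>a\<close> and \<open>b\<close>, exhaust its four
        neighbours. The tip \<open>w\<close> of \<open>t\<close> must then be \<open>a\<close> or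
        \<open>b\<close>, both of which are excluded.\<close>
      have ex: "\<exists>u v w. distinct [u, v, a, b] \<and> adj c u \<and> adj c v \<and> (on s u \<or> on t u) \<and> (on s v \<or> on t v)
          \<and> adj c w \<and> tip t w \<and> \<not> on s w"
      proof (cases "\<exists>x z. adj c x \<and> on s x \<and> adj c z \<and> on t z")
        case True
        then obtain x z where xz: "adj c x" "on s x" "adj c z" "on t z" by blast
        obtain w where w: "adj c w" "tip t w" "\<not> on s w"
          using single_contact_outside[OF s t st xz(4) nt(2) cs xz(3)] n by metis
        have "distinct [x, z, a, b]" using xz as nt f big_disjoint[OF s t st] by auto
        then show ?thesis using xz w by blast
      next
        case False
        then obtain w where w: "tip s c" "adj c w" "tip t w" "\<not> on s w" using mc n unfolding mid_def by blast
        obtain u v where u: "on s u" "on s v" "u \<noteq> v" "adj c u" "adj c v" using tip_neighbours[OF w(1)] .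
        then have "distinct [u, v, a, b]" using as f by auto
        then show ?thesis using u w by blast
      qed
      then obtain u v w where u: "distinct [u, v, a, b]" "adj c u" "adj c v" "on s u \<or> on t u" "on s v \<or> on t v"
          "adj c w" "tip t w" "\<not> on s w" by blast
      have "w = a \<or> w = b" using nbrs_eq[of c u v a b w] u bx tip_not_on by blast
      then show False using u nta n by blast
    qed
    then show ?thesis
    proof
      assume "tip t c"
      then show ?thesis using tb bx cs nt f(11) unfolding mid_def by blast
    next
      assume "tip t b"
      then show ?thesis using bx x nt f(11) tip_neighbours[of t b] unfolding mid_def by metis
    qed
  qed
qed

text \<open>All four neighbours of \<open>x\<close> are accounted for: \<open>a\<close> by
  assumption, \<open>b\<close> by \<open>rim_across\<close>, and \<open>p\<close>, \<open>q\<close>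
  by \<open>rim_side\<close> applied from \<open>a\<close> and from \<open>b\<close>.\<close>

lemma rim_neighbour:
  assumes s: "deg s \<ge> 8" and t: "deg t \<ge> 8" and st: "s \<noteq> t" and m: "rim s t x" and v: "adj x v"
  shows "band s t v"
proof -
  obtain a where a: "adj x a" "on t a \<or> mid s t a" and x: "on s x" using m unfolding rim_def by blast
  have as: "\<not> on s a" using a(2) big_disjoint[OF s t st] unfolding mid_def by blast
  obtain p q b A B C where f: "inc s x p" "inc s x q" "distinct [p, q, a, b]" "distinct [s, A, B, C]"
    "inc A x p" "inc A x a" "inc B x a" "inc B x b" "inc C x b" "inc C x q" "\<not> on s b"
    "deg B = 3 \<or> deg B = 4" "deg B = 4 \<Longrightarrow> deg A = 3 \<and> deg C = 3"
    using big_frame[OF s x a(1) as] by metis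
  have b: "on t b \<or> mid s t b" using rim_across[OF s t st x f a(2)] .
  have outer: "band s t c" if "on t c \<or> mid s t c" "adj x c" for c
    using that x adj_sym unfolding band_def rim_def by blast
  have pq: "rim s t p" "rim s t q"
    using rim_side[OF s t st f(1,5) _ f(6) _ a(2)] rim_side[OF s t st f(2,10) _ f(9) _ b] f by auto
  have "v = p \<or> v = q \<or> v = a \<or> v = b" using nbrs_eq[of x p q a b v] f adjI v by blast
  then show ?thesis using pq outer[OF b] outer[OF a(2,1)] f adjI unfolding band_def by blast
qed

lemma band_neighbour:
  assumes "deg s \<ge> 8" "deg t \<ge> 8" "s \<noteq> t" "band s t v" "adj v w"
  shows "band s t w"
  using assms rim_neighbour[of s t v w] rim_neighbour[of t s v w] mid_neighbour[of s t v w]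
  unfolding band_def[of s t v] by (metis band_commute)

end

section \<open>Arcs on a circle\<close>

text \<open>The coordinate \<open>h\<close> turns the two sides of a point of the circle into the
  order of the real line.\<close>

lemma punctured_circle_line:
  fixes F :: "complex set"
  assumes F: "F homeomorphic sphere (0::complex) 1" and a: "a \<in> F"
  obtains h k where "homeomorphism (F - {a}) (UNIV :: real set) h k"
proof -
  obtain f g where fg: "homeomorphism F (sphere (0::complex) 1) f g"
    using F unfolding homeomorphic_def by blast
  have fa: "f a \<in> sphere (0::complex) 1" using fg a unfolding homeomorphism_def by blast
  have im: "f ` (F - {a}) = sphere 0 1 - {f a}"
    using inj_on_image_set_diff[of f F F "{a}"] fg a unfolding homeomorphism_def inj_on_def by auto
  have "homeomorphism (F - {a}) (sphere 0 1 - {f a}) f g"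
    using homeomorphism_of_subsets[OF fg _ _ im] by auto
  then have "F - {a} homeomorphic sphere 0 1 - {f a}"
    unfolding homeomorphic_def by blast
  also have "sphere 0 1 - {f a} homeomorphic (UNIV :: real set)"
    using fa by (intro homeomorphic_punctured_sphere_affine) auto
  finally show thesis using that unfolding homeomorphic_def by blast
qed

text \<open>\<open>C\<close> is the arc without its ends. Reversing the path lets either end play
  the part of the starting point.\<close>

lemma arc_minus_endpoints:
  fixes g :: "real \<Rightarrow> complex"
  assumes g: "arc g" and x: "x \<in> {pathstart g, pathfinish g}"
  obtains y C where "path_image g = insert x (insert y C)" "x \<noteq> y" "x \<notin> C" "y \<notin> C"
    "connected C" "x \<in> closure C"
proof -
  have main: "\<exists>y C. path_image h = insert x (insert y C) \<and> x \<noteq> y \<and> x \<notin> C \<and> y \<notin> C \<and>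
    connected C \<and> x \<in> closure C"
    if h: "arc h" "x = pathstart h" for h :: "real \<Rightarrow> complex"
  proof (intro exI conjI)
    have c: "continuous_on {0..1} h" and i: "inj_on h {0..1}"
      using h by (auto simp: arc_def path_def)
    let ?C = "h ` {0<..<1}"
    have u: "{0..1} = insert 0 (insert 1 {0<..<1::real})" by auto
    show "path_image h = insert x (insert (pathfinish h) ?C)"
      unfolding path_image_def u using h by (simp add: pathstart_def pathfinish_def)
    show "x \<noteq> pathfinish h" using h arc_distinct_ends by metis
    show "x \<notin> ?C"
    proof
      assume "x \<in> ?C"
      then obtain r where "r \<in> {0<..<1}" "h r = h 0" using h by (auto simp: pathstart_def)
      then show False using inj_onD[OF i, of r 0] by auto
    qed
    show "pathfinish h \<notin> ?C"
    proof
      assume "pathfinish h \<in> ?C"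
      then obtain r where "r \<in> {0<..<1}" "h r = h 1" by (auto simp: pathfinish_def)
      then show False using inj_onD[OF i, of r 1] by auto
    qed
    show "connected ?C"
      by (intro connected_continuous_image continuous_on_subset[OF c]) auto
    have "h ` closure {0<..<1} \<subseteq> closure ?C"
      using c by (intro image_closure_subset closure_subset) auto
    then show "x \<in> closure ?C" using h by (auto simp: pathstart_def)
  qed
  show thesis
  proof (cases "x = pathstart g")
    case True
    then show thesis using main[OF g] that by blast
  next
    case False
    then have "x = pathstart (reversepath g)" using x by simp
    then obtain y C where yC: "path_image (reversepath g) = insert x (insert y C) \<and> x \<noteq> y \<and> x \<notin> C \<and>
      y \<notin> C \<and> connected C \<and> x \<in> closure C"
      using main[of "reversepath g"] g arc_reversepath by blast
    then show thesis using that by simp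
  qed
qed

text \<open>Exactly one open arc leaves \<open>x\<close> to the right. Existence: points just right
  of \<open>x\<close> avoid the closed set \<open>K\<close>, hence lie in some \<open>C e\<close>,
  and connectedness keeps all of \<open>C e\<close> on that side. Uniqueness: the images of two such
  arcs under \<open>h\<close> are intervals accumulating at \<open>h x\<close>, so they have a
  common value, against disjointness.\<close>

lemma unique_arc_on_side:
  fixes h :: "complex \<Rightarrow> real"
  assumes hk: "homeomorphism (F - {a}) UNIV h k"
    and x: "x \<in> F" "x \<noteq> a"
    and arcs: "\<And>e. e \<in> D \<Longrightarrow> connected (C e) \<and> x \<in> closure (C e) \<and> x \<notin> C e \<and> C e \<subseteq> F - {a}"
    and disj: "\<And>e e'. e \<in> D \<Longrightarrow> e' \<in> D \<Longrightarrow> e \<noteq> e' \<Longrightarrow> C e \<inter> C e' = {}"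
    and K: "closed K" "x \<notin> K" "F \<subseteq> insert x K \<union> (\<Union>e\<in>D. C e)"
  shows "\<exists>e\<in>D. \<forall>e'\<in>D. (\<forall>p\<in>C e'. h x < h p) \<longleftrightarrow> e' = e"
proof -
  have ch: "continuous_on (F - {a}) h" and ck: "continuous_on UNIV k"
    and kh: "\<And>p. p \<in> F - {a} \<Longrightarrow> k (h p) = p" and hk': "\<And>r. h (k r) = r"
    and kF: "\<And>r. k r \<in> F - {a}"
    using hk unfolding homeomorphism_def by auto
  have near: "\<exists>p\<in>C e. h p < r" if e: "e \<in> D" and r: "h x < r" for e r
  proof -
    obtain W where W: "open W" "W \<inter> (F - {a}) = h -` {..<r} \<inter> (F - {a})"
      using ch open_lessThan[of r] unfolding continuous_on_open_invariant by blast
    have "x \<in> W" using W(2) x r by blast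
    then have "C e \<inter> W \<noteq> {}" using arcs[OF e] open_Int_closure_eq_empty[OF W(1), of "C e"] by blast
    then show ?thesis using W(2) arcs[OF e] by blast
  qed
  have interval: "r \<in> h ` C e" if e: "e \<in> D" "\<forall>p\<in>C e. h x < h p" "h x < r" "p \<in> C e" "r \<le> h p" for e r p
  proof -
    obtain q where q: "q \<in> C e" "h q < r" using near[OF e(1,3)] by blast
    have "connected (h ` C e)"
      using arcs[OF e(1)] ch continuous_on_subset connected_continuous_image by blast
    then show ?thesis using connectedD_interval[of "h ` C e" "h q" "h p" r] q e by auto
  qed
  have side: "(\<forall>p\<in>C e. h x < h p)" if e: "e \<in> D" "p \<in> C e" "h x < h p" for e p
  proof
    fix q assume q: "q \<in> C e"
    have inF: "C e \<subseteq> F - {a}" "x \<notin> C e" using arcs[OF e(1)] by auto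
    have con: "connected (h ` C e)"
      using arcs[OF e(1)] ch continuous_on_subset connected_continuous_image by blast
    have "h x \<noteq> h p'" if "p' \<in> C e" for p'
      using kh x inF that by (metis DiffI singletonD subsetD)
    then have "h x \<notin> h ` C e" by auto
    then show "h x < h q"
      using connectedD_interval[OF con, of "h q" "h p" "h x"] e q by (cases "h x < h q") auto
  qed
  have "\<exists>e p. e \<in> D \<and> p \<in> C e \<and> h x < h p"
  proof -
    have "open (k -` (- K))" using ck K(1) by (simp add: open_vimage open_Compl)
    moreover have "h x \<in> k -` (- K)" using kh x K by auto
    ultimately obtain d where d: "d > 0" "ball (h x) d \<subseteq> k -` (- K)" using open_contains_ball by blast
    define p where "p = k (h x + d/2)"
    have hp: "h p = h x + d/2" by (simp add: p_def hk')
    have "h x + d/2 \<in> ball (h x) d" using d by (simp add: dist_real_def)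
    then have "p \<notin> K" using d by (auto simp: p_def)
    moreover have "p \<in> F" using kF by (auto simp: p_def)
    moreover have "p \<noteq> x" using hp d by auto
    ultimately obtain e where "e \<in> D" "p \<in> C e" using K(3) by blast
    moreover have "h x < h p" using hp d by simp
    ultimately show ?thesis by blast
  qed
  then obtain e p where e: "e \<in> D" "p \<in> C e" "h x < h p" by blast
  show ?thesis
  proof (intro bexI[of _ e] ballI iffI)
    show "e \<in> D" by (rule e(1))
    show "h x < h p" if "e' = e" "p \<in> C e'" for e' p using side[OF e] that by blast
    fix e' assume "e' \<in> D" "\<forall>p\<in>C e'. h x < h p"
    then have e': "e' \<in> D \<and> (\<forall>p\<in>C e'. h x < h p)" by blast
    show "e' = e"
    proof (rule ccontr)
      assume ne: "e' \<noteq> e"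
      obtain p' where p': "p' \<in> C e'" using e' near[of e' "h x + 1"] by auto
      define r where "r = min (h p) (h p')"
      have r: "h x < r" "r \<le> h p" "r \<le> h p'" using e e' p' by (auto simp: r_def)
      have "r \<in> h ` C e" "r \<in> h ` C e'"
        using interval[OF e(1) _ r(1) e(2) r(2)] interval[of e' r p'] side[OF e] e' r p' by auto
      moreover have "k r \<in> C d" if "d \<in> D" "r \<in> h ` C d" for d
        using that kh arcs[of d] by fastforce
      ultimately have "k r \<in> C e" "k r \<in> C e'" using e(1) e' by blast+
      then show False using disj[of e e'] e e' ne by blast
    qed
  qed
qed

text \<open>In a coordinate on the punctured circle, each open arc at \<open>x\<close> lies wholly
  on one side of \<open>x\<close>, and each side carries exactly one.\<close>

lemma two_arcs_at_circle_point:
  fixes F :: "complex set"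
  assumes F: "F homeomorphic sphere (0::complex) 1" and x: "x \<in> F"
    and D: "finite ES" "F = \<Union>ES"
    and arcs: "\<And>e. e \<in> ES \<Longrightarrow> closed e"
      "\<And>e. e \<in> ES \<Longrightarrow> x \<in> e \<Longrightarrow> \<exists>g. arc g \<and> path_image g = e \<and> x \<in> {pathstart g, pathfinish g}"
    and meet: "\<And>e e'. e \<in> ES \<Longrightarrow> e' \<in> ES \<Longrightarrow> e \<noteq> e' \<Longrightarrow> x \<in> e \<Longrightarrow> x \<in> e' \<Longrightarrow> e \<inter> e' = {x}"
  shows "card {e \<in> ES. x \<in> e} = 2"
proof -
  define D where "D = {e \<in> ES. x \<in> e}"
  have "\<exists>y C. e = insert x (insert y C) \<and> x \<noteq> y \<and> x \<notin> C \<and> y \<notin> C \<and> connected C \<and> x \<in> closure C"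
    if e: "e \<in> D" for e
  proof -
    obtain g where g: "arc g" "path_image g = e" "x \<in> {pathstart g, pathfinish g}"
      using arcs(2) e unfolding D_def by blast
    show ?thesis using arc_minus_endpoints[OF g(1,3)] g(2) by metis
  qed
  then obtain y C where yC: "\<And>e. e \<in> D \<Longrightarrow> e = insert x (insert (y e) (C e)) \<and> x \<noteq> y e \<and> x \<notin> C e \<and> y e \<notin> C e \<and>
      connected (C e) \<and> x \<in> closure (C e)"
    by metis
  have mem: "p \<in> e \<longleftrightarrow> p = x \<or> p = y e \<or> p \<in> C e" if "e \<in> D" for e p
    using yC[OF that] by blast
  have nx: "x \<noteq> y e" "x \<notin> C e" "y e \<notin> C e" "connected (C e)" "x \<in> closure (C e)" if "e \<in> D" for e
    using yC[OF that] by blast+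
  obtain e0 where e0: "e0 \<in> D" using x assms(4) by (auto simp: D_def)
  \<comment> \<open>Puncturing at the far end of one arc removes no point of any open arc, because
    distinct arcs at \<open>x\<close> meet only in \<open>x\<close>.\<close>
  define a where "a = y e0"
  have a: "a \<in> F" "x \<noteq> a" "a \<in> e0" using nx[OF e0] mem[OF e0] e0 assms(4) unfolding a_def D_def by blast+
  obtain h k where hk: "homeomorphism (F - {a}) (UNIV :: real set) h k"
    using punctured_circle_line[OF F a(1)] .
  define K where "K = \<Union>{e \<in> ES. x \<notin> e} \<union> y ` D"
  have fD: "finite D" using assms(3) by (simp add: D_def)
  have K: "closed K" "x \<notin> K" "F \<subseteq> insert x K \<union> (\<Union>e\<in>D. C e)"
  proof -
    show "closed K" unfolding K_def using assms(3) arcs(1) fD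
      by (intro closed_Un closed_Union finite_imp_closed finite_imageI) auto
    show "x \<notin> K" using nx unfolding K_def by blast
    show "F \<subseteq> insert x K \<union> (\<Union>e\<in>D. C e)"
    proof
      fix p assume "p \<in> F"
      then obtain e where e: "e \<in> ES" "p \<in> e" using assms(4) by auto
      show "p \<in> insert x K \<union> (\<Union>e\<in>D. C e)"
        using e mem[of e p] unfolding K_def D_def by blast
    qed
  qed
  have meetD: "e \<inter> e' = {x}" if "e \<in> D" "e' \<in> D" "e \<noteq> e'" for e e'
    using meet that by (auto simp: D_def)
  have sub: "C e \<subseteq> e" if "e \<in> D" for e using mem[OF that] by blast
  have aC: "a \<notin> C e" if e: "e \<in> D" for e
  proof
    assume ac: "a \<in> C e"
    show False
    proof (cases "e = e0")
      case True
      then show False using nx(3)[OF e0] ac by (simp add: a_def)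
    next
      case False
      have "a \<in> e \<inter> e0" using ac sub[OF e] a(3) by blast
      then show False using meetD[OF e e0 False] a(2) by simp
    qed
  qed
  have subF: "e \<subseteq> F" if e: "e \<in> D" for e
    using e assms(4) unfolding D_def by blast
  have arcs': "connected (C e) \<and> x \<in> closure (C e) \<and> x \<notin> C e \<and> C e \<subseteq> F - {a}" if e: "e \<in> D" for e
    using nx(2,4,5)[OF e] aC[OF e] subset_trans[OF sub[OF e] subF[OF e]] by (simp add: subset_Diff_insert)
  have disj: "C e \<inter> C e' = {}" if "e \<in> D" "e' \<in> D" "e \<noteq> e'" for e e'
  proof -
    have "C e \<inter> C e' \<subseteq> {x}" using meetD[OF that] Int_mono[OF sub[OF that(1)] sub[OF that(2)]] by simp
    then show ?thesis using nx(2)[OF that(1)] by blast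
  qed
  have "\<exists>e\<in>D. \<forall>e'\<in>D. (\<forall>p\<in>C e'. h x < h p) \<longleftrightarrow> e' = e"
    by (rule unique_arc_on_side[OF hk x a(2) arcs' disj K])
  then obtain e1 where e1: "e1 \<in> D" "\<And>e. e \<in> D \<Longrightarrow> (\<forall>p\<in>C e. h x < h p) \<longleftrightarrow> e = e1"
    by metis
  \<comment> \<open>Reversing the coordinate handles the left side.\<close>
  have neg: "homeomorphism (F - {a}) (UNIV :: real set) (\<lambda>p. - h p) (k \<circ> uminus)"
  proof -
    have "homeomorphism (UNIV :: real set) UNIV uminus uminus"
      by (auto simp: homeomorphism_def intro!: continuous_intros)
    then show ?thesis using homeomorphism_compose[OF hk] by (simp add: o_def)
  qed
  have "\<exists>e\<in>D. \<forall>e'\<in>D. (\<forall>p\<in>C e'. - h x < - h p) \<longleftrightarrow> e' = e"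
    by (rule unique_arc_on_side[OF neg x a(2) arcs' disj K])
  then obtain e2 where e2: "e2 \<in> D" "\<And>e. e \<in> D \<Longrightarrow> (\<forall>p\<in>C e. h p < h x) \<longleftrightarrow> e = e2"
    by (metis neg_less_iff_less)
  have ne: "C e \<noteq> {}" if "e \<in> D" for e using arcs'[OF that] by (metis closure_empty empty_iff)
  have "e1 \<noteq> e2"
  proof
    assume eq: "e1 = e2"
    obtain p where "p \<in> C e1" using ne[OF e1(1)] by blast
    moreover have "\<forall>p\<in>C e1. h x < h p" "\<forall>p\<in>C e1. h p < h x" using e1 e2 eq by blast+
    ultimately show False by (meson less_asym)
  qed
  moreover have "D = {e1, e2}"
  proof -
    have "e = e1 \<or> e = e2" if e: "e \<in> D" for e
    proof -
      have "continuous_on (C e) h"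
        using arcs'[OF e] homeomorphism_cont1[OF hk] continuous_on_subset by blast
      then have con: "connected (h ` C e)"
        using arcs'[OF e] connected_continuous_image by blast
      have "h x \<notin> h ` C e"
      proof
        assume "h x \<in> h ` C e"
        then obtain p where p: "p \<in> C e" "h p = h x" by auto
        have "k (h p) = p" "k (h x) = x" using homeomorphism_apply1[OF hk] arcs'[OF e] p x a(2) by blast+
        then have "p = x" using p(2) by metis
        then show False using p(1) nx(2)[OF e] by blast
      qed
      then have "\<not> (h p \<le> h x \<and> h x \<le> h q)" if "p \<in> C e" "q \<in> C e" for p q
        using connectedD_interval[OF con, of "h p" "h q" "h x"] that by blast
      then have "(\<forall>p\<in>C e. h x < h p) \<or> (\<forall>p\<in>C e. h p < h x)"
        by (meson not_le)
      then show ?thesis using e1(2)[OF e] e2(2)[OF e] by blast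
    qed
    then show ?thesis using e1(1) e2(1) by blast
  qed
  ultimately show ?thesis unfolding D_def by simp
qed

section \<open>The incidence structure of a tessellation\<close>

lemma card_2_other:
  assumes "card S = 2" "a \<in> S"
  obtains b where "b \<noteq> a" "\<And>c. c \<in> S \<longleftrightarrow> c = a \<or> c = b"
proof -
  obtain p q where S: "S = {p, q}" "p \<noteq> q" using assms(1) by (auto simp: card_2_iff)
  show thesis
  proof (cases "a = p")
    case True
    then show thesis using that[of q] S by auto
  next
    case False
    then show thesis using that[of p] S assms(2) by auto
  qed
qed

section \<open>Edges and vertices of a plane graph\<close>

context plane_graph
begin

lemma edge_compact: "e \<in> E \<Longrightarrow> compact e"
  by (metis edge_arc compact_arc_image)

lemma edge_vertices:
  assumes "e \<in> E" obtains x y where "e \<inter> V = {x, y}" "x \<noteq> y"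
proof -
  obtain g where g: "arc g" "e \<inter> V = {pathstart g, pathfinish g}" using edge_arc[OF assms] by blast
  show thesis using that[OF g(2)] arc_distinct_ends[OF g(1)] by metis
qed

lemma edge_other_vertex:
  assumes "e \<in> E" "x \<in> e" "x \<in> V" obtains y where "e \<inter> V = {x, y}" "x \<noteq> y"
proof -
  obtain a b where ab: "e \<inter> V = {a, b}" "a \<noteq> b" using edge_vertices[OF assms(1)] .
  have "x = a \<or> x = b" using assms(2,3) ab(1) by blast
  then show thesis
  proof
    assume "x = a"
    then show thesis using that[of b] ab by simp
  next
    assume "x = b"
    then show thesis using that[of a] ab by (simp add: insert_commute)
  qed
qed

text \<open>Distinct edges meet only in vertices, and a second common vertex would give them the
  same ends.\<close>

lemma edges_at_vertex_meet:
  assumes "e \<in> E" "e' \<in> E" "e \<noteq> e'" "x \<in> e" "x \<in> e'" "x \<in> V"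
  shows "e \<inter> e' = {x}"
proof -
  obtain y where y: "e \<inter> V = {x, y}" using edge_other_vertex assms by metis
  obtain y' where y': "e' \<inter> V = {x, y'}" using edge_other_vertex assms by metis
  have "y \<noteq> y' \<or> y = x" using edge_unique assms y y' by metis
  then show ?thesis using edge_inter[OF assms(1-3)] y y' assms by blast
qed

lemma closed_edges: "closed (\<Union>E)"
proof -
  have "locally_finite_in euclidean E"
    unfolding locally_finite_in_def
  proof (intro conjI ballI)
    fix p :: complex
    obtain r where "r > 0" "finite {e \<in> E. e \<inter> ball p r \<noteq> {}}" using locally_finite by blast
    then show "\<exists>U. openin euclidean U \<and> p \<in> U \<and> finite {e \<in> E. e \<inter> U \<noteq> {}}"
      by (intro exI[of _ "ball p r"]) auto
  qed auto
  then show ?thesis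
    using closedin_locally_finite_Union[of E euclidean] edge_compact compact_imp_closed by auto
qed

end

section \<open>Boundary circles of the faces\<close>

context infinite_planar_tessellation
begin

lemma vertex_on_edge:
  assumes "x \<in> V" obtains e where "e \<in> E" "x \<in> e"
proof -
  have "{e \<in> E. x \<in> e} \<noteq> {}"
    using vertex_degree_ge_3[OF assms] unfolding vertex_degree_def by (metis card.empty not_numeral_le_zero)
  then show thesis using that by blast
qed

text \<open>Every vertex lies on an edge, so the complement of the graph is that of the closed set
  \<open>\<Union>E\<close>.\<close>

lemma face_open: "\<sigma> \<in> faces V E \<Longrightarrow> open \<sigma>"
proof -
  have "V \<union> \<Union>E = \<Union>E" using vertex_on_edge by blast
  then have "open (- (V \<union> \<Union>E))" using closed_edges by (simp add: open_Compl)
  then show "\<sigma> \<in> faces V E \<Longrightarrow> open \<sigma>" unfolding faces_def using open_components by blast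
qed

lemma faces_disjoint: "\<sigma> \<in> faces V E \<Longrightarrow> \<tau> \<in> faces V E \<Longrightarrow> \<sigma> \<noteq> \<tau> \<Longrightarrow> \<sigma> \<inter> \<tau> = {}"
  unfolding faces_def using components_nonoverlap by blast

text \<open>An edge at \<open>x\<close> lies on a second face \<open>\<tau>\<close>. Were
  \<open>x\<close> interior to the closure of \<open>\<sigma>\<close>, the open set
  \<open>\<tau>\<close> would meet that closure and hence \<open>\<sigma>\<close> itself.\<close>

lemma vertex_on_frontier:
  assumes "\<sigma> \<in> faces V E" "x \<in> V" "x \<in> closure \<sigma>"
  shows "x \<in> frontier (closure \<sigma>)"
proof (rule ccontr)
  assume "\<not> ?thesis"
  then have i: "x \<in> interior (closure \<sigma>)" using assms(3) by (simp add: frontier_def)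
  obtain e where e: "e \<in> E" "x \<in> e" using vertex_on_edge[OF assms(2)] .
  have "\<exists>\<tau>. \<tau> \<noteq> \<sigma> \<and> \<tau> \<in> {\<tau> \<in> faces V E. e \<subseteq> closure \<tau>}"
    using edge_two_faces[OF e(1)] by (metis card_2_iff insertCI)
  then obtain \<tau> where \<tau>: "\<tau> \<noteq> \<sigma>" "\<tau> \<in> faces V E" "x \<in> closure \<tau>" using e by blast
  have "interior (closure \<sigma>) \<inter> \<tau> \<noteq> {}"
    using open_Int_closure_eq_empty[of "interior (closure \<sigma>)" \<tau>] i \<tau>(3) by auto
  then have "\<tau> \<inter> closure \<sigma> \<noteq> {}" using interior_subset by blast
  then have "\<tau> \<inter> \<sigma> \<noteq> {}" using open_Int_closure_eq_empty[OF face_open[OF \<tau>(2)], of \<sigma>] by simp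
  then show False using faces_disjoint[OF \<tau>(2) assms(1) \<tau>(1)] by simp
qed

lemma two_boundary_edges:
  assumes \<sigma>: "\<sigma> \<in> faces V E" and x: "x \<in> V" "x \<in> closure \<sigma>"
  shows "card {e \<in> boundary_edges E \<sigma>. x \<in> e} = 2"
proof (rule two_arcs_at_circle_point[of "frontier (closure \<sigma>)"])
  \<comment> \<open>By invariance of domain, a homeomorphism of closed plane sets matches their
    frontiers; so the frontier is a circle.\<close>
  have "frontier (closure \<sigma>) homeomorphic frontier (cball (0::complex) 1)"
    by (rule homeomorphic_frontiers_same_dimension[OF face_disk[OF \<sigma>]]) auto
  then show "frontier (closure \<sigma>) homeomorphic sphere (0::complex) 1" by simp
  show "x \<in> frontier (closure \<sigma>)" using vertex_on_frontier[OF \<sigma> x] .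
  show "finite (boundary_edges E \<sigma>)" "frontier (closure \<sigma>) = \<Union>(boundary_edges E \<sigma>)"
    using face_bounded_by_edges[OF \<sigma>] by auto
  show "closed e" if "e \<in> boundary_edges E \<sigma>" for e
    using that edge_compact compact_imp_closed by (auto simp: boundary_edges_def)
  show "\<exists>g. arc g \<and> path_image g = e \<and> x \<in> {pathstart g, pathfinish g}"
    if e: "e \<in> boundary_edges E \<sigma>" "x \<in> e" for e
    using edge_arc[of e] e x unfolding boundary_edges_def by blast
  show "e \<inter> e' = {x}" if "e \<in> boundary_edges E \<sigma>" "e' \<in> boundary_edges E \<sigma>" "e \<noteq> e'" "x \<in> e" "x \<in> e'" for e e'
    using edges_at_vertex_meet that x unfolding boundary_edges_def by blast
qed

text \<open>Edges are determined by their ends, so a finite \<open>V\<close> makes the whole graph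
  bounded. Its complement then has an unbounded component, which is not contained in a disk.\<close>

lemma infinite_vertices: "infinite V"
proof
  assume fin: "finite V"
  have "inj_on (\<lambda>e. e \<inter> V) E" using edge_unique by (auto simp: inj_on_def)
  moreover have "(\<lambda>e. e \<inter> V) ` E \<subseteq> Pow V" by auto
  ultimately have "finite E" using fin by (meson finite_Pow_iff finite_imageD finite_subset)
  then have "bounded (V \<union> \<Union>E)"
    using finite_imp_bounded[OF fin] bounded_Union[of E] edge_compact compact_imp_bounded
    by (meson bounded_Un)
  then obtain \<sigma> where \<sigma>: "\<sigma> \<in> faces V E" "\<not> bounded \<sigma>"
    using cobounded_unbounded_components[of "- (V \<union> \<Union>E)"] unfolding faces_def by auto
  have "compact (closure \<sigma>)" using face_disk[OF \<sigma>(1)] homeomorphic_compactness compact_cball by blast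
  then show False using \<sigma>(2) compact_imp_bounded bounded_subset closure_subset by blast
qed

section \<open>Incidence of faces with pairs of vertices\<close>

definition incident :: "complex set \<Rightarrow> complex \<Rightarrow> complex \<Rightarrow> bool" where
  "incident \<sigma> x y \<longleftrightarrow> \<sigma> \<in> faces V E \<and> x \<noteq> y \<and> (\<exists>e\<in>boundary_edges E \<sigma>. e \<inter> V = {x, y})"

lemma incident_sym: "incident \<sigma> x y \<Longrightarrow> incident \<sigma> y x"
  unfolding incident_def by (metis insert_commute)

lemma incident_vertex:
  assumes "incident \<sigma> x y"
  shows "\<sigma> \<in> faces V E \<and> x \<in> V \<and> x \<in> closure \<sigma>"
proof -
  obtain e where e: "\<sigma> \<in> faces V E" "e \<subseteq> closure \<sigma>" "e \<inter> V = {x, y}"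
    using assms unfolding incident_def boundary_edges_def by blast
  have "x \<in> e \<inter> V" using e(3) by simp
  then show ?thesis using e(1,2) by blast
qed

lemma incident_corner:
  assumes "incident \<sigma> x y"
  shows "\<exists>z. z \<noteq> y \<and> (\<forall>w. incident \<sigma> x w \<longleftrightarrow> w = y \<or> w = z)"
proof -
  have x: "\<sigma> \<in> faces V E" "x \<in> V" "x \<in> closure \<sigma>" using incident_vertex[OF assms] by auto
  obtain e where e: "e \<in> boundary_edges E \<sigma>" "e \<inter> V = {x, y}" "x \<noteq> y"
    using assms unfolding incident_def by blast
  have xe: "x \<in> e" using e(2) by blast
  obtain e' where e': "e' \<noteq> e" "\<And>d. d \<in> {e \<in> boundary_edges E \<sigma>. x \<in> e} \<longleftrightarrow> d = e \<or> d = e'"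
    using card_2_other[OF two_boundary_edges[OF x], of e] e(1) xe by blast
  have be: "e' \<in> boundary_edges E \<sigma>" "x \<in> e'" using e'(2)[of e'] by blast+
  then have E: "e \<in> E" "e' \<in> E" using e(1) unfolding boundary_edges_def by blast+
  obtain z where z: "e' \<inter> V = {x, z}" "x \<noteq> z" using edge_other_vertex[OF E(2) be(2) x(2)] .
  have "z \<noteq> y" using edge_unique[OF E] z(1) e(2) e'(1) by metis
  moreover have "incident \<sigma> x w \<longleftrightarrow> w = y \<or> w = z" for w
  proof
    assume "incident \<sigma> x w"
    then obtain d where d: "d \<in> boundary_edges E \<sigma>" "d \<inter> V = {x, w}" unfolding incident_def by blast
    have "x \<in> d" using d(2) by blast
    then have "d = e \<or> d = e'" using e'(2)[of d] d(1) by blast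
    then show "w = y \<or> w = z" using d(2) e(2) z(1) by (metis doubleton_eq_iff)
  next
    assume "w = y \<or> w = z"
    then show "incident \<sigma> x w"
    proof
      assume "w = z"
      then show ?thesis using x(1) be(1) z unfolding incident_def by blast
    qed (use assms in simp)
  qed
  ultimately show ?thesis by blast
qed

lemma on_face_incident:
  assumes "\<sigma> \<in> faces V E" "x \<in> V" "x \<in> closure \<sigma>"
  shows "\<exists>y. incident \<sigma> x y"
proof -
  have "{e \<in> boundary_edges E \<sigma>. x \<in> e} \<noteq> {}"
    using two_boundary_edges[OF assms] by (metis card.empty zero_neq_numeral)
  then obtain e where e: "e \<in> boundary_edges E \<sigma>" "x \<in> e" by blast
  then obtain y where "e \<inter> V = {x, y}" "x \<noteq> y"
    using edge_other_vertex[of e x] assms(2) unfolding boundary_edges_def by blast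
  then show ?thesis using e assms unfolding incident_def by blast
qed

lemma incident_two_faces:
  assumes "incident \<sigma> x y"
  shows "\<exists>\<tau>. \<tau> \<noteq> \<sigma> \<and> (\<forall>\<rho>. incident \<rho> x y \<longleftrightarrow> \<rho> = \<sigma> \<or> \<rho> = \<tau>)"
proof -
  obtain e where e: "e \<in> E" "e \<subseteq> closure \<sigma>" "e \<inter> V = {x, y}" "x \<noteq> y" "\<sigma> \<in> faces V E"
    using assms unfolding incident_def boundary_edges_def by blast
  obtain \<tau> where \<tau>: "\<tau> \<noteq> \<sigma>" "\<And>\<rho>. \<rho> \<in> {\<rho> \<in> faces V E. e \<subseteq> closure \<rho>} \<longleftrightarrow> \<rho> = \<sigma> \<or> \<rho> = \<tau>"
    using card_2_other[OF edge_two_faces[OF e(1)], of \<sigma>] e(2,5) by blast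
  have inc: "incident \<rho> x y \<longleftrightarrow> \<rho> \<in> {\<rho> \<in> faces V E. e \<subseteq> closure \<rho>}" for \<rho>
  proof
    assume "incident \<rho> x y"
    then obtain d where d: "d \<in> E" "d \<subseteq> closure \<rho>" "d \<inter> V = {x, y}" "\<rho> \<in> faces V E"
      unfolding incident_def boundary_edges_def by blast
    have "d = e" using edge_unique[OF d(1) e(1)] d(3) e(3) by simp
    then show "\<rho> \<in> {\<rho> \<in> faces V E. e \<subseteq> closure \<rho>}" using d by blast
  next
    assume "\<rho> \<in> {\<rho> \<in> faces V E. e \<subseteq> closure \<rho>}"
    then show "incident \<rho> x y" using e(1,3,4) unfolding incident_def boundary_edges_def by blast
  qed
  show ?thesis using \<tau>(1) unfolding inc \<tau>(2) by (intro exI[of _ \<tau>]) simp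
qed

lemma adjacent_iff_incident: "adjacent V E x y \<longleftrightarrow> (\<exists>\<sigma>. incident \<sigma> x y)"
proof
  assume "adjacent V E x y"
  then obtain e where e: "e \<in> E" "e \<inter> V = {x, y}" "x \<noteq> y" unfolding adjacent_def by blast
  have "{\<sigma> \<in> faces V E. e \<subseteq> closure \<sigma>} \<noteq> {}"
    using edge_two_faces[OF e(1)] by (metis card.empty zero_neq_numeral)
  then obtain \<sigma> where "\<sigma> \<in> faces V E" "e \<subseteq> closure \<sigma>" by blast
  then show "\<exists>\<sigma>. incident \<sigma> x y" using e unfolding incident_def boundary_edges_def by blast
next
  assume "\<exists>\<sigma>. incident \<sigma> x y"
  then show "adjacent V E x y" unfolding incident_def adjacent_def boundary_edges_def by blast
qed

lemma card_adjacent: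
  assumes "x \<in> V" shows "card {y. adjacent V E x y} = vertex_degree E x"
proof -
  have "(\<lambda>e. e \<inter> V) ` {e \<in> E. x \<in> e} = (\<lambda>y. {x, y}) ` {y. adjacent V E x y}"
  proof (intro equalityI subsetI)
    fix p assume "p \<in> (\<lambda>e. e \<inter> V) ` {e \<in> E. x \<in> e}"
    then obtain e where e: "e \<in> E" "x \<in> e" "p = e \<inter> V" by blast
    obtain y where y: "e \<inter> V = {x, y}" "x \<noteq> y" using edge_other_vertex[OF e(1,2) assms] .
    then have "adjacent V E x y" using e(1) unfolding adjacent_def by blast
    then show "p \<in> (\<lambda>y. {x, y}) ` {y. adjacent V E x y}" using y(1) e(3) by simp
  next
    fix p assume "p \<in> (\<lambda>y. {x, y}) ` {y. adjacent V E x y}"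
    then obtain y where y: "adjacent V E x y" "p = {x, y}" by blast
    then obtain e where e: "e \<in> E" "e \<inter> V = {x, y}" unfolding adjacent_def by blast
    have "x \<in> e" using e(2) by blast
    then show "p \<in> (\<lambda>e. e \<inter> V) ` {e \<in> E. x \<in> e}" using e y(2) by (intro image_eqI[of _ _ e]) simp_all
  qed
  moreover have "inj_on (\<lambda>e. e \<inter> V) {e \<in> E. x \<in> e}"
    using edge_unique by (intro inj_onI) blast
  moreover have "inj_on (\<lambda>y. {x, y}) {y. adjacent V E x y}"
    by (intro inj_onI) (metis doubleton_eq_iff)
  ultimately show ?thesis unfolding vertex_degree_def by (metis (lifting) card_image)
qed

text \<open>Two common vertices exclude an empty or one-point intersection, so the closures meet in
  an edge, whose only vertices are \<open>x\<close> and \<open>y\<close>.\<close>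

lemma incident_faces_meet:
  assumes "\<sigma> \<noteq> \<tau>" "x \<noteq> y" "incident \<sigma> x x1" "incident \<tau> x x2" "incident \<sigma> y y1" "incident \<tau> y y2"
  shows "incident \<sigma> x y \<and> (\<forall>z z1 z2. incident \<sigma> z z1 \<longrightarrow> incident \<tau> z z2 \<longrightarrow> z = x \<or> z = y)"
proof -
  have xy: "x \<in> V" "y \<in> V" "x \<in> closure \<sigma> \<inter> closure \<tau>" "y \<in> closure \<sigma> \<inter> closure \<tau>"
    and f: "\<sigma> \<in> faces V E" "\<tau> \<in> faces V E"
    using assms incident_vertex by blast+
  have "closure \<sigma> \<inter> closure \<tau> \<noteq> {u}" for u
    using xy(3,4) assms(2) by (metis singletonD)
  then obtain e where e: "e \<in> E" "closure \<sigma> \<inter> closure \<tau> = e"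
    using face_inter[OF f assms(1)] xy(3) by (metis empty_iff)
  have "x \<in> e" "y \<in> e" using xy(3,4) e(2) by simp_all
  then have eV: "e \<inter> V = {x, y}"
    using edge_other_vertex[OF e(1) _ xy(1)] xy(2) assms(2) by (metis IntI insertE singletonD)
  have "e \<subseteq> closure \<sigma>" using e(2) by blast
  then have "incident \<sigma> x y"
    using e(1) eV f(1) assms(2) unfolding incident_def boundary_edges_def by blast
  moreover have "z = x \<or> z = y" if "incident \<sigma> z z1" "incident \<tau> z z2" for z z1 z2
  proof -
    have "z \<in> e \<inter> V" using incident_vertex[OF that(1)] incident_vertex[OF that(2)] e(2) by auto
    then show ?thesis using eV by simp
  qed
  ultimately show ?thesis by blast
qed

lemma card_incident_pairs:
  assumes "\<sigma> \<in> faces V E"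
  shows "card {{x, y} | x y. incident \<sigma> x y} = face_degree E \<sigma>"
proof -
  have "{{x, y} | x y. incident \<sigma> x y} = (\<lambda>e. e \<inter> V) ` boundary_edges E \<sigma>"
  proof (intro equalityI subsetI)
    fix p assume "p \<in> (\<lambda>e. e \<inter> V) ` boundary_edges E \<sigma>"
    then obtain e where e: "e \<in> boundary_edges E \<sigma>" "p = e \<inter> V" by blast
    then obtain x y where "e \<inter> V = {x, y}" "x \<noteq> y" using edge_vertices[of e] unfolding boundary_edges_def by blast
    then show "p \<in> {{x, y} | x y. incident \<sigma> x y}" using e assms unfolding incident_def by blast
  qed (auto simp: incident_def)
  moreover have "inj_on (\<lambda>e. e \<inter> V) (boundary_edges E \<sigma>)"
    using edge_unique by (auto simp: inj_on_def boundary_edges_def)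
  ultimately show ?thesis unfolding face_degree_def by (simp add: card_image)
qed

text \<open>With \<open>w\<close> the second neighbour of \<open>y\<close> on the face, the pairs
  \<open>xy\<close>, \<open>xz\<close>, \<open>yw\<close> are all three boundary edges. The second
  boundary edge at \<open>z\<close> must be among them, which forces \<open>w = z\<close>.\<close>

lemma incident_triangle:
  assumes d: "face_degree E \<sigma> = 3" and xy: "incident \<sigma> x y" and xz: "incident \<sigma> x z" and yz: "y \<noteq> z"
  shows "incident \<sigma> y z"
proof -
  let ?P = "{{x, y} | x y. incident \<sigma> x y}"
  have f: "\<sigma> \<in> faces V E" using incident_vertex[OF xy] by blast
  have c: "card ?P = 3" using card_incident_pairs[OF f] d by simp
  have ne: "x \<noteq> y" "x \<noteq> z" using xy xz by (auto simp: incident_def)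
  obtain w where w: "w \<noteq> x" "incident \<sigma> y w" using incident_corner[OF incident_sym[OF xy]] by blast
  have "y \<noteq> w" using w by (auto simp: incident_def)
  obtain v where v: "v \<noteq> x" "incident \<sigma> z v" using incident_corner[OF incident_sym[OF xz]] by blast
  have "z \<noteq> v" using v by (auto simp: incident_def)
  have "{{x,y},{x,z},{y,w}} \<subseteq> ?P" using xy xz w by blast
  moreover have "card {{x,y},{x,z},{y,w}} = 3"
    using ne yz w \<open>y \<noteq> w\<close> by (auto simp: doubleton_eq_iff card_insert_if)
  ultimately have "{{x,y},{x,z},{y,w}} = ?P" using c by (metis (no_types, lifting) card_subset_eq card.infinite zero_neq_numeral)
  moreover have "{z, v} \<in> ?P" using v by blast
  ultimately have "{z,v} \<in> {{x,y},{x,z},{y,w}}" by simp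
  then have "w = z" using v ne yz \<open>z \<noteq> v\<close> by (auto simp: doubleton_eq_iff)
  then show ?thesis using w by simp
qed

text \<open>If \<open>y\<close> and \<open>z\<close> were joined, \<open>x\<close>,
  \<open>y\<close>, \<open>z\<close> would form a closed triangle; a fourth edge \<open>ab\<close>
  would avoid it, and the second edge at \<open>a\<close> would be a fifth. Otherwise
  \<open>xy\<close>, \<open>xz\<close>, \<open>yw\<close>, \<open>zv\<close> are all the edges, and
  the second edge at \<open>w\<close> can only be \<open>zv\<close>, so
  \<open>w = v\<close>.\<close>

lemma incident_square:
  assumes d: "face_degree E \<sigma> = 4" and xy: "incident \<sigma> x y" and xz: "incident \<sigma> x z" and yz: "y \<noteq> z"
  shows "\<exists>w. w \<noteq> x \<and> w \<noteq> y \<and> w \<noteq> z \<and> incident \<sigma> y w \<and> incident \<sigma> z w"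
proof -
  let ?P = "{{x, y} | x y. incident \<sigma> x y}"
  have f: "\<sigma> \<in> faces V E" using incident_vertex[OF xy] by blast
  have c: "card ?P = 4" using card_incident_pairs[OF f] d by simp
  then have fin: "finite ?P" by (metis (no_types, lifting) card.infinite zero_neq_numeral)
  have ne: "x \<noteq> y" "x \<noteq> z" using xy xz by (auto simp: incident_def)
  obtain w where w: "w \<noteq> x" "\<And>u. incident \<sigma> y u \<longleftrightarrow> u = x \<or> u = w" using incident_corner[OF incident_sym[OF xy]] by blast
  have "y \<noteq> w" using w by (auto simp: incident_def)
  obtain v where v: "v \<noteq> x" "\<And>u. incident \<sigma> z u \<longleftrightarrow> u = x \<or> u = v" using incident_corner[OF incident_sym[OF xz]] by blast
  have "z \<noteq> v" using v by (auto simp: incident_def)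
  have x2: "incident \<sigma> x u \<longleftrightarrow> u = y \<or> u = z" for u using incident_corner[OF xy] xz yz by metis
  have "w \<noteq> z"
  proof
    assume "w = z"
    then have zy: "incident \<sigma> z y" using w(2) incident_sym by blast
    then have "v = y" using v(2)[of y] ne(1) by simp
    have closed: "q \<in> {x,y,z}" if "incident \<sigma> p q" "p \<in> {x,y,z}" for p q
      using that x2 w(2) v(2) \<open>w = z\<close> \<open>v = y\<close> by auto
    have "card {{x,y},{x,z},{y,z}} < card ?P" unfolding c by (simp add: card_insert_if)
    then have "\<not> ?P \<subseteq> {{x,y},{x,z},{y,z}}"
      by (metis (no_types, lifting) card_mono finite.emptyI finite_insert not_le)
    then obtain a b where ab: "incident \<sigma> a b" "{a, b} \<notin> {{x,y},{x,z},{y,z}}" by blast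
    have "a \<noteq> b" using ab(1) by (auto simp: incident_def)
    have a: "a \<notin> {x,y,z}"
      using ab(2) closed[OF ab(1)] \<open>a \<noteq> b\<close> by (auto simp: doubleton_eq_iff)
    have b: "b \<notin> {x,y,z}" using closed[OF incident_sym[OF ab(1)]] a by blast
    obtain b' where b': "b' \<noteq> b" "incident \<sigma> a b'" using incident_corner[OF ab(1)] by blast
    have a': "b' \<notin> {x,y,z}" using closed[OF incident_sym[OF b'(2)]] a by blast
    have "{{x,y},{x,z},{y,z},{a,b},{a,b'}} \<subseteq> ?P" using xy xz ab(1) b'(2) incident_sym[OF zy] by blast
    from card_mono[OF fin this] have "card {{x,y},{x,z},{y,z},{a,b},{a,b'}} \<le> 4" unfolding c .
    moreover have "card {{x,y},{x,z},{y,z},{a,b},{a,b'}} = 5"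
      using a b a' b'(1) ne yz by (auto simp: doubleton_eq_iff card_insert_if)
    ultimately show False by simp
  qed
  have "v \<noteq> y" using v(2)[of y] w(2)[of z] \<open>w \<noteq> z\<close> ne(2) incident_sym[of \<sigma> z y] by auto
  have "{{x,y},{x,z},{y,w},{z,v}} \<subseteq> ?P" using xy xz w(2)[of w] v(2)[of v] by blast
  moreover have "card {{x,y},{x,z},{y,w},{z,v}} = 4"
    using ne yz w(1) v(1) \<open>y \<noteq> w\<close> \<open>z \<noteq> v\<close> \<open>w \<noteq> z\<close> \<open>v \<noteq> y\<close> by (auto simp: doubleton_eq_iff card_insert_if)
  ultimately have P: "{{x,y},{x,z},{y,w},{z,v}} = ?P" using card_subset_eq[OF fin] c by simp
  have "incident \<sigma> w y" using w(2)[of w] incident_sym by blast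
  then obtain u where u: "u \<noteq> y" "incident \<sigma> w u" using incident_corner by metis
  have "{w, u} \<in> ?P" using u(2) by blast
  then have "{w, u} \<in> {{x,y},{x,z},{y,w},{z,v}}" using P by simp
  then have "w = v" using u(1) \<open>y \<noteq> w\<close> \<open>w \<noteq> z\<close> w(1) by (auto simp: doubleton_eq_iff)
  then show ?thesis using w(1) w(2)[of w] v(2)[of v] \<open>w \<noteq> z\<close> \<open>y \<noteq> w\<close> by blast
qed

end

section \<open>Curvature bounds and the concluding connectedness argument\<close>

locale regular_nonneg_tessellation = infinite_planar_tessellation +
  assumes regular: "x \<in> V \<Longrightarrow> vertex_degree E x = 4"
    and nonneg: "x \<in> V \<Longrightarrow> curvature V E x \<ge> 0"
begin

sublocale four_regular_map incident
proof
  show "card {z. \<exists>\<tau>. incident \<tau> x z} = 4" if "incident \<sigma> x y" for \<sigma> x y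
    using card_adjacent[of x] regular[of x] incident_vertex[OF that]
    by (simp flip: adjacent_iff_incident)
  show "x \<noteq> y" if "incident \<sigma> x y" for \<sigma> x y using that by (simp add: incident_def)
qed (fact incident_sym incident_corner incident_two_faces incident_faces_meet)+

lemma on_iff: "on \<sigma> x \<longleftrightarrow> \<sigma> \<in> faces V E \<and> x \<in> V \<and> x \<in> closure \<sigma>"
proof
  assume "on \<sigma> x"
  then obtain y where "incident \<sigma> x y" unfolding on_def by (rule exE)
  then show "\<sigma> \<in> faces V E \<and> x \<in> V \<and> x \<in> closure \<sigma>" by (rule incident_vertex)
next
  assume "\<sigma> \<in> faces V E \<and> x \<in> V \<and> x \<in> closure \<sigma>"
  then show "on \<sigma> x" using on_face_incident[of \<sigma> x] unfolding on_def by simp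
qed

lemma adj_iff: "adj x y \<longleftrightarrow> adjacent V E x y"
  unfolding adj_def adjacent_iff_incident by simp

text \<open>The four faces of the frame are all the faces at \<open>x\<close>, so with degree 4 the
  condition becomes that their reciprocal degrees sum to at least 1.\<close>

lemma curvature_frame:
  assumes p: "incident \<sigma> x p"
  obtains \<tau> \<mu> \<nu> where "distinct [\<sigma>, \<tau>, \<mu>, \<nu>]" "\<And>\<rho> u. incident \<rho> x u \<Longrightarrow> \<rho> \<in> {\<sigma>, \<tau>, \<mu>, \<nu>}"
    "1 / face_degree E \<sigma> + 1 / face_degree E \<tau> + 1 / face_degree E \<mu> + 1 / face_degree E \<nu> \<ge> 1"
    "face_degree E \<tau> \<ge> 3" "face_degree E \<mu> \<ge> 3" "face_degree E \<nu> \<ge> 3"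
proof -
  obtain q where q: "incident \<sigma> x q" "p \<noteq> q" using incident_corner[OF p] by metis
  obtain a b \<tau> \<mu> \<nu> where f: "distinct [p, q, a, b]" "distinct [\<sigma>, \<tau>, \<mu>, \<nu>]"
    "incident \<tau> x p" "incident \<tau> x a" "incident \<mu> x a" "incident \<mu> x b" "incident \<nu> x b" "incident \<nu> x q"
    using frame[OF p q] .
  have all: "\<rho> \<in> {\<sigma>, \<tau>, \<mu>, \<nu>}" if "incident \<rho> x u" for \<rho> u
    using faces_of_frame[OF p q(1) f that] .
  have x: "x \<in> V" using incident_vertex[OF p] by blast
  have "\<rho> \<in> {\<rho> \<in> faces V E. x \<in> closure \<rho>} \<longleftrightarrow> \<rho> \<in> {\<sigma>, \<tau>, \<mu>, \<nu>}" for \<rho>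
  proof
    assume "\<rho> \<in> {\<rho> \<in> faces V E. x \<in> closure \<rho>}"
    then show "\<rho> \<in> {\<sigma>, \<tau>, \<mu>, \<nu>}" using on_face_incident[of \<rho> x] x all by blast
  next
    assume "\<rho> \<in> {\<sigma>, \<tau>, \<mu>, \<nu>}"
    then have "\<exists>u. incident \<rho> x u" using p f by auto
    then show "\<rho> \<in> {\<rho> \<in> faces V E. x \<in> closure \<rho>}" using incident_vertex by blast
  qed
  then have "{\<rho> \<in> faces V E. x \<in> closure \<rho>} = {\<sigma>, \<tau>, \<mu>, \<nu>}" by blast
  then have sum: "1 / face_degree E \<sigma> + 1 / face_degree E \<tau> + 1 / face_degree E \<mu> + 1 / face_degree E \<nu> \<ge> 1"
    using nonneg[OF x] f(2) unfolding curvature_def by (simp add: regular[OF x])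
  have ge: "face_degree E \<tau> \<ge> 3" "face_degree E \<mu> \<ge> 3" "face_degree E \<nu> \<ge> 3"
    using f face_degree_ge_3 incident_vertex by blast+
  show thesis by (rule that[OF f(2) _ sum ge]) (rule all)
qed

lemma one_over_le: "n \<ge> m \<Longrightarrow> m > 0 \<Longrightarrow> 1 / real n \<le> 1 / real m"
  by (simp add: frac_le)

sublocale four_regular_map_with_large_faces incident "face_degree E"
proof
  fix s x u f v assume s: "8 \<le> face_degree E s" "incident s x u" and f: "incident f x v" "f \<noteq> s"
  obtain \<tau> \<mu> \<nu> where fr: "distinct [s, \<tau>, \<mu>, \<nu>]" "\<And>\<rho> u. incident \<rho> x u \<Longrightarrow> \<rho> \<in> {s, \<tau>, \<mu>, \<nu>}"
    and sum: "1 / face_degree E s + 1 / face_degree E \<tau> + 1 / face_degree E \<mu> + 1 / face_degree E \<nu> \<ge> 1"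
    and ge: "face_degree E \<tau> \<ge> 3" "face_degree E \<mu> \<ge> 3" "face_degree E \<nu> \<ge> 3"
    using curvature_frame[OF s(2)] by blast
  have bound: "1 / real (face_degree E s) \<le> 1 / 8" "1 / real (face_degree E \<tau>) \<le> 1 / 3"
    "1 / real (face_degree E \<mu>) \<le> 1 / 3" "1 / real (face_degree E \<nu>) \<le> 1 / 3"
    using one_over_le[OF s(1)] one_over_le[OF ge(1)] one_over_le[OF ge(2)] one_over_le[OF ge(3)] by simp_all
  have f4: "f = \<tau> \<or> f = \<mu> \<or> f = \<nu>" using fr(2)[OF f(1)] f(2) by blast
  have f3: "face_degree E f \<ge> 3" using f4 ge by blast
  have "\<not> face_degree E f \<ge> 5"
  proof
    assume "face_degree E f \<ge> 5"
    then have "1 / real (face_degree E f) \<le> 1 / 5" using one_over_le[of 5] by simp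
    \<comment> \<open>The sum would be at most 1/8 + 1/5 + 1/3 + 1/3 = 119/120.\<close>
    then show False using f4 sum bound by auto
  qed
  then show "face_degree E f = 3 \<or> face_degree E f = 4" using f3 by linarith
  fix g w assume g: "incident g x w" "g \<noteq> s" "f \<noteq> g" and d: "face_degree E f = 4"
  have g4: "g = \<tau> \<or> g = \<mu> \<or> g = \<nu>" using fr(2)[OF g(1)] g(2) by blast
  have g3: "face_degree E g \<ge> 3" using g4 ge by blast
  have "\<not> face_degree E g \<ge> 4"
  proof
    assume "face_degree E g \<ge> 4"
    then have "1 / real (face_degree E g) \<le> 1 / 4" using one_over_le[of 4] by simp
    moreover have "1 / real (face_degree E f) \<le> 1 / 4" using d by simp
    \<comment> \<open>The sum would be at most 1/8 + 1/4 + 1/4 + 1/3 = 23/24.\<close>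
    ultimately show False using f4 g4 g(3) sum bound by auto
  qed
  then show "face_degree E g = 3" using g3 by linarith
qed (fact incident_triangle incident_square)+

lemma finite_face_vertices:
  assumes "\<sigma> \<in> faces V E" shows "finite {x. on \<sigma> x}"
proof -
  have "{x. on \<sigma> x} \<subseteq> \<Union>((\<lambda>e. e \<inter> V) ` boundary_edges E \<sigma>)"
  proof
    fix x assume "x \<in> {x. on \<sigma> x}"
    then obtain y where "incident \<sigma> x y" unfolding on_def by blast
    then show "x \<in> \<Union>((\<lambda>e. e \<inter> V) ` boundary_edges E \<sigma>)" unfolding incident_def by blast
  qed
  moreover have "finite (e \<inter> V)" if e: "e \<in> boundary_edges E \<sigma>" for e
  proof -
    have "e \<in> E" using e by (simp add: boundary_edges_def)
    then obtain x y where "e \<inter> V = {x, y}" using edge_vertices by metis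
    then show ?thesis by simp
  qed
  moreover have "finite (boundary_edges E \<sigma>)" using face_bounded_by_edges[OF assms] by blast
  ultimately show ?thesis by (meson finite_UN_I finite_subset)
qed

lemma finite_band:
  assumes s: "s \<in> faces V E" and t: "t \<in> faces V E"
  shows "finite {v. band s t v}"
proof -
  let ?B = "{x. on s x} \<union> {x. on t x}"
  have "{v. band s t v} \<subseteq> ?B \<union> (\<Union>x\<in>?B. {v. adj x v})"
  proof
    fix v assume "v \<in> {v. band s t v}"
    then have "on s v \<or> on t v \<or> (\<exists>x. (on s x \<or> on t x) \<and> adj v x)" using band_near by simp
    then show "v \<in> ?B \<union> (\<Union>x\<in>?B. {v. adj x v})" using adj_sym by blast
  qed
  moreover have "finite ?B" using finite_face_vertices[OF s] finite_face_vertices[OF t] by simp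
  moreover have "finite {v. adj x v}" for x
  proof (cases "\<exists>a. adj x a")
    case True
    then show ?thesis using nbrs_finite by blast
  qed simp
  ultimately show ?thesis
    by (meson finite_UN_I finite_UnI finite_subset)
qed

text \<open>By connectedness a nonempty band would contain every vertex, although it is finite and
  \<open>V\<close> is infinite.\<close>

lemma no_band:
  assumes "s \<in> faces V E" "t \<in> faces V E" "face_degree E s \<ge> 8" "face_degree E t \<ge> 8" "s \<noteq> t"
  shows "\<not> band s t v"
proof
  assume v: "band s t v"
  have aV: "w \<in> V" if a: "adj w u" for w u
  proof -
    obtain \<rho> where "incident \<rho> w u" using a unfolding adj_def by (rule exE)
    then show ?thesis using incident_vertex[of \<rho> w u] by simp
  qed
  have vV: "v \<in> V" using band_near[OF v] aV[of v] by (auto simp: on_iff)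
  have reach: "band s t w" if "(adjacent V E)\<^sup>*\<^sup>* v w" for w
    using that
  proof (induction rule: rtranclp_induct)
    case (step x y)
    have "adj x y" using step(2) by (simp add: adj_iff)
    then show ?case using band_neighbour[OF assms(3,4,5) step(3)] by simp
  qed (rule v)
  have "V \<subseteq> {w. band s t w}" using reach[OF connected_graph[OF vV]] by (simp add: subset_iff)
  then show False using finite_subset[OF _ finite_band[OF assms(1,2)]] infinite_vertices by simp
qed

lemma neighborhood1_iff:
  assumes "\<sigma> \<in> faces V E"
  shows "x \<in> neighborhood1 V E \<sigma> \<longleftrightarrow> on \<sigma> x \<or> (\<exists>z. on \<sigma> z \<and> adj x z)"
proof -
  have "adjacent V E x z \<Longrightarrow> x \<in> V" for z unfolding adjacent_def by blast
  then show ?thesis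
    unfolding neighborhood1_def face_vertices_def on_iff adj_iff using assms by auto
qed

text \<open>A common vertex of the neighbourhoods lies on both faces, lies on one and is adjacent to
  the other (a rim vertex), or is off both and adjacent to both (a middle vertex). The first case
  contradicts \<open>big_disjoint\<close>, the others \<open>no_band\<close>.\<close>

lemma neighborhoods_disjoint:
  assumes s: "s \<in> faces V E" and t: "t \<in> faces V E"
    and big: "face_degree E s \<ge> 8" "face_degree E t \<ge> 8" and st: "s \<noteq> t"
  shows "neighborhood1 V E s \<inter> neighborhood1 V E t = {}"
proof -
  have "\<not> (on s v \<and> on t v)" for v using big_disjoint[OF big st] by blast
  moreover have "\<not> (on s x \<and> on t z \<and> adj x z)" for x z
    using no_band[OF s t big st, of x] unfolding band_def rim_def by blast
  moreover have "\<not> (\<not> on s v \<and> \<not> on t v \<and> on s x \<and> on t z \<and> adj v x \<and> adj v z)" for v x z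
    using no_band[OF s t big st, of v] unfolding band_def mid_def by blast
  ultimately show ?thesis
    using neighborhood1_iff[OF s] neighborhood1_iff[OF t] adj_sym by (metis disjoint_iff)
qed

end

theorem theorem4p1:
  fixes V :: "complex set" and E :: "complex set set"
    and \<sigma>\<^sub>1 \<sigma>\<^sub>2 :: "complex set" and k\<^sub>1 k\<^sub>2 :: nat
  assumes "infinite_planar_tessellation V E"
    and "\<forall>x\<in>V. vertex_degree E x = 4"
    and "\<forall>x\<in>V. curvature V E x \<ge> 0"
    and "\<sigma>\<^sub>1 \<in> faces V E" and "face_degree E \<sigma>\<^sub>1 = k\<^sub>1" and "k\<^sub>1 \<ge> 8"
    and "\<sigma>\<^sub>2 \<in> faces V E" and "face_degree E \<sigma>\<^sub>2 = k\<^sub>2" and "k\<^sub>2 \<ge> 8"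
    and "\<sigma>\<^sub>1 \<noteq> \<sigma>\<^sub>2"
  shows "neighborhood1 V E \<sigma>\<^sub>1 \<inter> neighborhood1 V E \<sigma>\<^sub>2 = {}"
proof -
  interpret infinite_planar_tessellation V E by fact
  interpret regular_nonneg_tessellation V E
    using assms(2,3) by unfold_locales auto
  show ?thesis using neighborhoods_disjoint[of \<sigma>\<^sub>1 \<sigma>\<^sub>2] assms by simp
qed

end
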